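(* Let $d,K,N\ge1$ be integers, $\ell\in\mathbb{N}_0$. Let $\pi_1,\ldots,\pi_K\ge 0$ with $\sum_k\pi_k=1$, $\mu_1,\ldots,\mu_K\in\mathbb{R}^d$, and let $\Sigma_1,\ldots,\Sigma_K$ be symmetric positive semidefinite (possibly singular) real $d\times d$ matrices. For $\eta>0$ let $P_\eta=\sum_{k=1}^K\pi_k N(\mu_k,\eta\Sigma_k)$ and let $X^{(\eta)}=(X^{(\eta)}_1,\ldots,X^{(\eta)}_N)$ be a random vector of $\mathbb{R}^d$-valued random variables each with marginal distribution $P_\eta$ (not necessarily independent). Let $\mathcal{L}\in\{\mathcal{L}_{\ell,\mathrm{total}},\mathcal{L}_{\ell,\mathrm{max}}\}$. Then for any $p\ge1$ there exist constants $C^{(0)}_{\ell,p}(N),C^{(1)}_{\ell,p}(N)>0$, independent of $\eta$, such that $$\mathbb{E}\left[\mathcal{L}(X^{(\eta)})^p\right]\le C^{(0)}_{\ell,p}(N)+C^{(1)}_{\ell,p}(N)\,\eta^{p/2},\qquad \eta>0. $$ Moreover, this inequality holds with the explicit choice $$C^{(0)}_{\ell,p}(N)=M_p\,C^{\mathrm{VR}}_{\ell,p}(N),\qquad C^{(1)}_{\ell,p}(N)=V_p\,C^{\mathrm{VR}}_{\ell,p}(N),$$ where $$M_p=2^{p-1}\sum_{k=1}^K\pi_k\|\mu_k\|^p,\quad V_p=2^{p-1}\kappa_{d,p}\sum_{k=1}^K\pi_k(\mathrm{tr}\,\Sigma_k)^{p/2},\quad C^{\mathrm{VR}}_{\ell,p}(N)=2^pN\left(\min\left\{\tbinom{N}{\ell+1},\tbinom{N}{\ell+2}\right\}\right)^p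 .$$ In particular, for the same $p$ and with $C_{\ell,p}(N):=C^{(0)}_{\ell,p}(N)+C^{(1)}_{\ell,p}(N)$, $$\sup_{\eta\ge1}\mathbb{E}\left[\left(\mathcal{L}(X^{(\eta)})/\sqrt{\eta}\right)^p\right]\le C_{\ell,p}(N).$$
   Context: $\|\cdot\|$ is the Euclidean norm. $N(\mu,\Sigma)$ denotes the Gaussian law with mean $\mu$ and covariance $\Sigma\succeq0$, i.e. the law of $\mu+\Sigma^{1/2}Z$ with $Z\sim N(0,I_d)$ and $\Sigma^{1/2}$ the positive semidefinite square root. $\kappa_{d,p}:=\mathbb{E}[\|Z\|^p]=2^{p/2}\Gamma(\frac{d+p}{2})/\Gamma(\frac d2)$ for $Z\sim N(0,I_d)$. For $x=(x_1,\ldots,x_N)\in(\mathbb{R}^d)^N$ the Vietoris--Rips filtration on the full simplex (all nonempty subsets $\sigma\subset\{1,\ldots,N\}$) is $\Phi_\sigma(x):=\max_{i,j\in\sigma}\|x_i-x_j\|$. $\mathcal{D}_\ell(x)$ denotes its persistence diagram in homological degree $\ell$ (coefficients in $\mathbb{Z}/2\mathbb{Z}$): the finite multiset of birth--death pairs $(b,d)$ with $b<d\le\infty$. Define $\mathcal{L}_{\ell,\mathrm{total}}(x)=\sum_{(b,d)\in\mathcal{D}_\ell(x),\,d<\infty}(d-b)$ (with multiplicities) and $\mathcal{L}_{\ell,\mathrm{max}}(x)=\max_{(b,d)\in\mathcal{D}_\ell(x),\,d<\infty}(d-b)$, both equal to $0$ if there is no finite pair. *)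

theory Defs
  imports "HOL-Probability.Probability" "HOL-Library.Function_Algebras" "HOL-Library.Z2"
begin

text \<open>
  A finite simplicial complex is given by its set of nonempty simplices. An \<open>l\<close>-chain is
  represented by its coefficient function.
\<close>

type_synonym chain = "nat set \<Rightarrow> bit"

global_interpretation chain: vector_space "\<lambda>(a::bit) (c::chain) \<sigma>. a * c \<sigma>"
  defines chain_dim = chain.dim
  by unfold_locales (auto simp: fun_eq_iff algebra_simps)

definition chains :: "nat \<Rightarrow> nat set set \<Rightarrow> chain set" where
  "chains l K = {c. \<forall>\<sigma>. c \<sigma> \<noteq> 0 \<longrightarrow> \<sigma> \<in> K \<and> card \<sigma> = l + 1}"

text \<open>
  The coefficient of \<open>\<tau>\<close> in the boundary of a chain is the sum of the coefficients of the simplices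
  that have \<open>\<tau>\<close> as a codimension-one face. Homology is not reduced: the empty set is no simplex,
  so the boundary of a vertex is \<open>0\<close>.
\<close>

definition boundary :: "nat set set \<Rightarrow> chain \<Rightarrow> chain" where
  "boundary K c = (\<lambda>\<tau>. if \<tau> = {} then 0 else (\<Sum>\<sigma> | \<sigma> \<in> K \<and> (\<exists>v\<in>\<sigma>. \<tau> = \<sigma> - {v}). c \<sigma>))"

definition cycles :: "nat \<Rightarrow> nat set set \<Rightarrow> chain set" where
  "cycles l K = {c \<in> chains l K. boundary K c = 0}"

definition boundaries :: "nat \<Rightarrow> nat set set \<Rightarrow> chain set" where
  "boundaries l K = boundary K ` chains (l + 1) K"

text \<open>
  For complexes \<open>K \<subseteq> L\<close>, the image of the map \<open>H\<^sub>l(K) \<rightarrow> H\<^sub>l(L)\<close> induced by inclusion is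
  \<open>Z\<^sub>l(K) / (Z\<^sub>l(K) \<inter> B\<^sub>l(L))\<close>; its dimension is the persistent Betti number of the pair.
\<close>

definition persistent_betti :: "nat \<Rightarrow> nat set set \<Rightarrow> nat set set \<Rightarrow> nat" where
  "persistent_betti l K L = chain_dim (cycles l K) - chain_dim (cycles l K \<inter> boundaries l L)"

definition full_simplex :: "nat \<Rightarrow> nat set set" where
  "full_simplex N = {\<sigma>. \<sigma> \<subseteq> {1..N} \<and> \<sigma> \<noteq> {}}"

definition vr_filtration :: "(nat \<Rightarrow> 'a::real_normed_vector) \<Rightarrow> nat set \<Rightarrow> real" where
  "vr_filtration x \<sigma> = Max {norm (x i - x j) | i j. i \<in> \<sigma> \<and> j \<in> \<sigma>}"

definition vr_le :: "nat \<Rightarrow> (nat \<Rightarrow> 'a::real_normed_vector) \<Rightarrow> ereal \<Rightarrow> nat set set" where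
  "vr_le N x t = {\<sigma> \<in> full_simplex N. ereal (vr_filtration x \<sigma>) \<le> t}"

definition vr_less :: "nat \<Rightarrow> (nat \<Rightarrow> 'a::real_normed_vector) \<Rightarrow> ereal \<Rightarrow> nat set set" where
  "vr_less N x t = {\<sigma> \<in> full_simplex N. ereal (vr_filtration x \<sigma>) < t}"

definition vr_values :: "nat \<Rightarrow> (nat \<Rightarrow> 'a::real_normed_vector) \<Rightarrow> real set" where
  "vr_values N x = vr_filtration x ` full_simplex N"

text \<open>
  Multiplicity of the pair \<open>(b, d)\<close>. Let \<open>t\<^sub>1 < \<dots> < t\<^sub>n\<close> be the filtration values and
  \<open>\<beta>(i, j)\<close> the rank of \<open>H\<^sub>l(K\<^sub>i) \<rightarrow> H\<^sub>l(K\<^sub>j)\<close>, with \<open>K\<^sub>i\<close> the sublevel complex at \<open>t\<^sub>i\<close> and \<open>K\<^sub>0\<close> empty. The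
  multiplicity of \<open>(t\<^sub>i, t\<^sub>j)\<close> is \<open>(\<beta>(i, j - 1) - \<beta>(i - 1, j - 1)) - (\<beta>(i, j) - \<beta>(i - 1, j))\<close> and that
  of \<open>(t\<^sub>i, \<infinity>)\<close> is \<open>\<beta>(i, n) - \<beta>(i - 1, n)\<close>. The predecessor of the complex at \<open>t\<^sub>i\<close> is the strict
  sublevel complex at \<open>t\<^sub>i\<close>.
\<close>

definition vr_multiplicity ::
  "nat \<Rightarrow> nat \<Rightarrow> (nat \<Rightarrow> 'a::real_normed_vector) \<Rightarrow> real \<Rightarrow> ereal \<Rightarrow> int" where
  "vr_multiplicity l N x b d =
     (int (persistent_betti l (vr_le N x b) (vr_less N x d))
        - int (persistent_betti l (vr_less N x b) (vr_less N x d)))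
     - (if d = \<infinity> then 0
        else int (persistent_betti l (vr_le N x b) (vr_le N x d))
               - int (persistent_betti l (vr_less N x b) (vr_le N x d)))"

definition vr_diagram ::
  "nat \<Rightarrow> nat \<Rightarrow> (nat \<Rightarrow> 'a::real_normed_vector) \<Rightarrow> (real \<times> ereal) multiset" where
  "vr_diagram l N x =
     (\<Sum>(b, d) \<in> {(b, d). b \<in> vr_values N x \<and> d \<in> insert \<infinity> (ereal ` vr_values N x) \<and> ereal b < d}.
        replicate_mset (nat (vr_multiplicity l N x b d)) (b, d))"

definition finite_pairs :: "(real \<times> ereal) multiset \<Rightarrow> (real \<times> ereal) multiset" where
  "finite_pairs D = filter_mset (\<lambda>(b, d). d < \<infinity>) D"

definition lifetime :: "real \<times> ereal \<Rightarrow> real" where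
  "lifetime = (\<lambda>(b, d). real_of_ereal d - b)"

definition total_persistence :: "nat \<Rightarrow> nat \<Rightarrow> (nat \<Rightarrow> 'a::real_normed_vector) \<Rightarrow> real" where
  "total_persistence l N x = (\<Sum>q \<in># finite_pairs (vr_diagram l N x). lifetime q)"

definition max_persistence :: "nat \<Rightarrow> nat \<Rightarrow> (nat \<Rightarrow> 'a::real_normed_vector) \<Rightarrow> real" where
  "max_persistence l N x =
     (let D = finite_pairs (vr_diagram l N x)
      in if D = {#} then 0 else Max (lifetime ` set_mset D))"

definition pos_semidef :: "real^'n^'n \<Rightarrow> bool" where
  "pos_semidef A \<longleftrightarrow> transpose A = A \<and> (\<forall>v. 0 \<le> v \<bullet> (A *v v))"

definition psd_sqrt :: "real^'n^'n \<Rightarrow> real^'n^'n" where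
  "psd_sqrt A = (THE S. pos_semidef S \<and> S ** S = A)"

definition std_gaussian :: "(real^'n) measure" where
  "std_gaussian = density lborel (\<lambda>z. ennreal (\<Prod>i\<in>UNIV. std_normal_density (z $ i)))"

definition gaussian :: "real^'n \<Rightarrow> real^'n^'n \<Rightarrow> (real^'n) measure" where
  "gaussian m A = distr std_gaussian borel (\<lambda>z. m + psd_sqrt A *v z)"

definition gaussian_mixture ::
  "nat \<Rightarrow> (nat \<Rightarrow> real) \<Rightarrow> (nat \<Rightarrow> real^'n) \<Rightarrow> (nat \<Rightarrow> real^'n^'n) \<Rightarrow> (real^'n) measure" where
  "gaussian_mixture K w m A =
     measure_of UNIV (sets borel)
       (\<lambda>E. \<Sum>k = 1..K. ennreal (w k) * emeasure (gaussian (m k) (A k)) E)"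

definition gaussian_moment :: "'n::finite itself \<Rightarrow> real \<Rightarrow> real" where
  "gaussian_moment _ p = (\<integral>z. norm z powr p \<partial>(std_gaussian :: (real^'n) measure))"

definition mean_const :: "nat \<Rightarrow> (nat \<Rightarrow> real) \<Rightarrow> (nat \<Rightarrow> real^'n) \<Rightarrow> real \<Rightarrow> real" where
  "mean_const K w m p = 2 powr (p - 1) * (\<Sum>k = 1..K. w k * norm (m k) powr p)"

definition cov_const :: "nat \<Rightarrow> (nat \<Rightarrow> real) \<Rightarrow> (nat \<Rightarrow> real^'n^'n) \<Rightarrow> real \<Rightarrow> real" where
  "cov_const K w A p =
     2 powr (p - 1) * gaussian_moment TYPE('n) p * (\<Sum>k = 1..K. w k * trace (A k) powr (p / 2))"

definition vr_const :: "nat \<Rightarrow> real \<Rightarrow> nat \<Rightarrow> real" where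
  "vr_const l p N =
     2 powr p * real N * real (min (N choose (l + 1)) (N choose (l + 2))) powr p"

end

theory Submission
  imports Defs
begin

text \<open>
  The multiplicity of a finite pair \<open>(b, d)\<close> is the second difference of the numbers
  \<open>dim (Z\<^sub>l(K\<^sub>b) \<inter> B\<^sub>l(K\<^sub>d))\<close>. Supermodularity of the dimension makes it nonnegative, and summing it
  first over \<open>b\<close> and then over \<open>d\<close> telescopes: there are at most \<open>dim B\<^sub>l\<close> finite pairs, where \<open>B\<^sub>l\<close>
  is the space of boundaries of the full simplex. This space consists of \<open>l\<close>-chains and is the
  image of the \<open>(l + 1)\<close>-chains, which gives the two binomial coefficients. Since every lifetime is
  at most the diameter \<open>\<le> 2 max\<^sub>i \<parallel>x\<^sub>i\<parallel>\<close>, the \<open>p\<close>-th moment of the persistence reduces to that of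
  the marginals, and for a Gaussian the bound \<open>\<parallel>\<Sigma>\<^sup>1\<^sup>/\<^sup>2 z\<parallel>\<^sup>2 \<le> tr \<Sigma> \<parallel>z\<parallel>\<^sup>2\<close> and convexity of \<open>t\<^sup>p\<close>
  conclude.
\<close>

text \<open>Several obstacles lie outside the counting argument. The index set of the diagram varies
  with the points, so measurability is proved by rewriting both functionals over fixed pairs of
  simplices, with coefficients that depend only on a random preorder. \<open>psd_sqrt\<close> is a
  definite description, and \<open>gaussian_moment\<close> is a Bochner integral, which would be 0
  for a function that is not integrable; hence the spectral theorem and the finiteness of Gaussian
  norm moments have to be established. In the constants, \<open>2 powr p\<close> comes from the
  diameter, \<open>2 powr (p - 1)\<close> from convexity, and the factor \<open>N\<close> from
  bounding the largest of the norms, raised to the power \<open>p\<close>, by a sum. That sum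
  involves the marginal laws only, so the joint law may be arbitrary.\<close>

section \<open>Chains over the field with two elements\<close>

text \<open>
  These simplification rules rewrite the field operations to bit operations, after which the facts
  about the vector space of chains no longer apply.
\<close>

declare add_bit_eq_xor [simp del] mult_bit_eq_and [simp del] minus_bit_def [simp del]

abbreviation bit_scale :: "bit \<Rightarrow> chain \<Rightarrow> chain" where
  "bit_scale a c \<equiv> (\<lambda>\<sigma>. a * c \<sigma>)"

text \<open>
  The space of all chains is infinite dimensional, so the dimension theory of finite-dimensional
  spaces is not available. Over the field with two elements counting replaces it.
\<close>

lemma card_eq_power_chain_dim:
  assumes S: "chain.subspace S" and fin: "finite S"
  shows "card S = 2 ^ chain_dim S"
proof -
  obtain B where B: "B \<subseteq> S" "chain.independent B" "S \<subseteq> chain.span B" "card B = chain_dim S"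
    using chain.basis_exists[of S] by auto
  have finB: "finite B" using B(1) fin finite_subset by auto
  have span: "chain.span B = S"
    using B S by (simp add: chain.span_subspace)
  \<comment> \<open>Coordinates with respect to the basis; on extensional functions this map is a
    bijection onto \<open>S\<close>.\<close>
  define f where "f = (\<lambda>u. \<Sum>v\<in>B. bit_scale (u v) v)"
  have "inj_on f (B \<rightarrow>\<^sub>E UNIV)"
  proof (rule inj_onI)
    fix u u' assume u: "u \<in> B \<rightarrow>\<^sub>E UNIV" "u' \<in> B \<rightarrow>\<^sub>E UNIV" "f u = f u'"
    have "(\<Sum>v\<in>B. bit_scale (u v - u' v) v) = f u - f u'"
      unfolding f_def sum_subtractf[symmetric]
      by (rule sum.cong) (auto simp: fun_eq_iff algebra_simps)
    then have "(\<Sum>v\<in>B. bit_scale (u v - u' v) v) = 0" using u by simp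
    then have "u v - u' v = 0" if "v \<in> B" for v
      using that by (rule chain.independentD[OF B(2) finB subset_refl])
    then have "u v = u' v" if "v \<in> B" for v
      using that by (simp only: right_minus_eq)
    then show "u = u'" using u(1,2) by (rule PiE_ext[rotated -1])
  qed
  moreover have "f ` (B \<rightarrow>\<^sub>E UNIV) = S"
  proof -
    have "f ` (B \<rightarrow>\<^sub>E UNIV) = range f"
    proof safe
      fix u :: "chain \<Rightarrow> bit"
      have "f u = f (restrict u B)" by (auto simp: f_def intro!: sum.cong)
      then show "f u \<in> f ` (B \<rightarrow>\<^sub>E UNIV)" by auto
    qed auto
    also have "\<dots> = chain.span B" using chain.span_finite[OF finB] by (simp add: f_def)
    finally show ?thesis using span by simp
  qed
  ultimately have "card S = card (B \<rightarrow>\<^sub>E (UNIV :: bit set))"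
    by (metis card_image)
  also have "\<dots> = 2 ^ card B"
  proof -
    have "UNIV = {0, 1 :: bit}" using bit.exhaust by blast
    then have "card (UNIV :: bit set) = card {0, 1 :: bit}" by (simp only:)
    then have "card (UNIV :: bit set) = 2" by simp
    then show ?thesis using finB by (simp add: card_PiE)
  qed
  finally show ?thesis using B(4) by simp
qed

lemma chain_dim_mono:
  assumes "chain.subspace S" "chain.subspace T" "finite T" "S \<subseteq> T"
  shows "chain_dim S \<le> chain_dim T"
proof -
  have "2 ^ chain_dim S \<le> (2 ^ chain_dim T :: nat)"
    using assms by (metis card_eq_power_chain_dim card_mono finite_subset)
  then show ?thesis by simp
qed

text \<open>Addition maps \<open>U \<times> V\<close> into \<open>W\<close>, and each nonempty fibre
  is a translate of a copy of \<open>U \<inter> V\<close>. Counting gives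
  \<open>card U * card V \<le> card W * card (U \<inter> V)\<close>; the claim is its logarithm to
  base 2.\<close>

lemma chain_dim_modular_le:
  assumes U: "chain.subspace U" and V: "chain.subspace V" and W: "chain.subspace W"
    and fin: "finite W" and sub: "U \<subseteq> W" "V \<subseteq> W"
  shows "chain_dim U + chain_dim V \<le> chain_dim W + chain_dim (U \<inter> V)"
proof -
  have finU: "finite U" "finite V" using finite_subset[OF _ fin] sub by blast+
  define f where "f = (\<lambda>(u :: chain, v). u + v)"
  have img: "f ` (U \<times> V) \<subseteq> W"
    using sub W by (auto simp: f_def intro!: chain.subspace_add)
  have fibre: "card {q \<in> U \<times> V. f q = w} \<le> card (U \<inter> V)" for w
  proof (cases "\<exists>q. q \<in> U \<times> V \<and> f q = w")
    case True
    then obtain u0 v0 where q0: "u0 \<in> U" "v0 \<in> V" "u0 + v0 = w" by (auto simp: f_def)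
    \<comment> \<open>On a fibre the first component determines the second, so it suffices to record
      its offset from the base point \<open>u0\<close>.\<close>
    show ?thesis
    proof (rule card_inj_on_le)
      show "inj_on (\<lambda>q. fst q - u0) {q \<in> U \<times> V. f q = w}"
        by (auto simp: inj_on_def f_def)
      show "(\<lambda>q. fst q - u0) ` {q \<in> U \<times> V. f q = w} \<subseteq> U \<inter> V"
      proof safe
        fix u v assume uv: "u \<in> U" "v \<in> V" "w = f (u, v)"
        show "fst (u, v) - u0 \<in> U" using U uv q0 by (simp add: chain.subspace_diff)
        have "u - u0 = v0 - v" using uv q0 by (simp add: f_def algebra_simps)
        then show "fst (u, v) - u0 \<in> V" using V uv q0 by (simp add: chain.subspace_diff)
      qed
    qed (use finU in auto)
  next
    case False
    then have "{q \<in> U \<times> V. f q = w} = {}" by blast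
    then show ?thesis by (simp only: card.empty)
  qed
  have "card U * card V = card (U \<times> V)" by (rule card_cartesian_product[symmetric])
  also have "\<dots> = card (\<Union>w\<in>W. {q \<in> U \<times> V. f q = w})"
    using img by (intro arg_cong[where f=card]) auto
  also have "\<dots> \<le> (\<Sum>w\<in>W. card {q \<in> U \<times> V. f q = w})"
    by (rule card_UN_le[OF fin])
  also have "\<dots> \<le> card W * card (U \<inter> V)"
    using sum_bounded_above[of W] fibre by (metis (no_types, lifting) of_nat_id)
  finally have "card U * card V \<le> card W * card (U \<inter> V)" .
  moreover have "chain.subspace (U \<inter> V)" using U V by (simp add: chain.subspace_inter)
  ultimately have "(2::nat) ^ (chain_dim U + chain_dim V) \<le> 2 ^ (chain_dim W + chain_dim (U \<inter> V))"
    using U V W fin finU by (simp add: card_eq_power_chain_dim power_add)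
  then show ?thesis by simp
qed

text \<open>The only scalars are 0 and 1, so closure under scaling is automatic.\<close>

lemma chain_subspace_iff:
  "chain.subspace S \<longleftrightarrow> 0 \<in> S \<and> (\<forall>x\<in>S. \<forall>y\<in>S. x + y \<in> S)"
proof (intro iffI chain.subspaceI conjI)
  fix a c assume S: "0 \<in> S \<and> (\<forall>x\<in>S. \<forall>y\<in>S. x + y \<in> S)" and c: "c \<in> S"
  show "bit_scale a c \<in> S"
  proof (cases a)
    assume "a = 0"
    then have "bit_scale a c = 0" by (simp only: mult_zero_left zero_fun_def)
    then show ?thesis using S by (simp only:)
  next
    assume "a = 1"
    then have "bit_scale a c = c" by (simp only: mult_1_left)
    then show ?thesis using c by (simp only:)
  qed
qed (blast intro: chain.subspace_0 chain.subspace_add)+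

section \<open>Chain, cycle and boundary spaces of nested complexes\<close>

lemma finite_full_simplex [simp]: "finite (full_simplex N)"
  unfolding full_simplex_def by (rule finite_subset[of _ "Pow {1..N}"]) auto

lemma boundary_add: "boundary K (c + c') = boundary K c + boundary K c'"
  unfolding boundary_def fun_eq_iff plus_fun_apply sum.distrib by simp

lemma boundary_zero: "boundary K 0 = 0"
  by (simp add: boundary_def fun_eq_iff)

lemma subspace_chains: "chain.subspace (chains l K)"
  unfolding chain_subspace_iff
proof safe
  show "0 \<in> chains l K" by (simp add: chains_def)
  fix x y assume xy: "x \<in> chains l K" "y \<in> chains l K"
  have "x \<sigma> \<noteq> 0 \<or> y \<sigma> \<noteq> 0" if "(x + y) \<sigma> \<noteq> 0" for \<sigma>
    using that by (cases "x \<sigma>") (simp_all add: plus_fun_def)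
  then show "x + y \<in> chains l K" using xy unfolding chains_def by blast
qed

lemma subspace_cycles: "chain.subspace (cycles l K)"
  using subspace_chains[of l K]
  unfolding chain_subspace_iff cycles_def by (simp add: boundary_add boundary_zero)

lemma subspace_boundaries: "chain.subspace (boundaries l K)"
  unfolding chain_subspace_iff boundaries_def
proof safe
  note chains = subspace_chains[of "l + 1" K, unfolded chain_subspace_iff]
  show "0 \<in> boundary K ` chains (l + 1) K"
    using chains by (intro image_eqI[of _ _ 0]) (simp_all add: boundary_zero)
  fix x y assume "x \<in> chains (l + 1) K" "y \<in> chains (l + 1) K"
  then show "boundary K x + boundary K y \<in> boundary K ` chains (l + 1) K"
    using chains by (intro image_eqI[of _ _ "x + y"]) (simp_all only: boundary_add)
qed

text \<open>The additional summands vanish, since a chain of \<open>K\<close> is zero outside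
  \<open>K\<close>. This allows cycles and boundaries of nested complexes to be compared inside one
  chain space.\<close>

lemma boundary_cong_complex:
  assumes "finite L" "K \<subseteq> L" "c \<in> chains l K"
  shows "boundary L c = boundary K c"
  using assms unfolding boundary_def fun_eq_iff
  by (auto intro!: sum.mono_neutral_right simp: chains_def)

lemma chains_mono: "K \<subseteq> L \<Longrightarrow> chains l K \<subseteq> chains l L"
  by (auto simp: chains_def)

lemma cycles_mono:
  assumes "finite L" "K \<subseteq> L"
  shows "cycles l K \<subseteq> cycles l L"
  using boundary_cong_complex[OF assms] chains_mono[OF assms(2), of l] unfolding cycles_def by auto

lemma boundaries_mono:
  assumes "finite L" "K \<subseteq> L"
  shows "boundaries l K \<subseteq> boundaries l L"
proof
  fix b assume "b \<in> boundaries l K"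
  then obtain c where "c \<in> chains (l + 1) K" "b = boundary K c" by (auto simp: boundaries_def)
  then have "c \<in> chains (l + 1) L" "b = boundary L c"
    using boundary_cong_complex[OF assms] chains_mono[OF assms(2), of "l + 1"] by auto
  then show "b \<in> boundaries l L" by (auto simp: boundaries_def)
qed

text \<open>A chain is determined by its support, which may be any set of \<open>l\<close>-simplices
  of \<open>K\<close>.\<close>

lemma card_chains:
  assumes "finite K"
  shows "finite (chains l K)" "card (chains l K) = 2 ^ card {\<sigma> \<in> K. card \<sigma> = l + 1}"
proof -
  let ?F = "{\<sigma> \<in> K. card \<sigma> = l + 1}"
  define supp where "supp = (\<lambda>c :: chain. {\<sigma>. c \<sigma> \<noteq> 0})"
  have inj: "inj supp"
  proof (rule injI)
    fix c c' :: chain assume "supp c = supp c'"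
    then show "c = c'"
      unfolding supp_def fun_eq_iff set_eq_iff mem_Collect_eq by (metis bit.exhaust)
  qed
  have img: "supp ` chains l K = Pow ?F"
  proof safe
    fix T assume "T \<subseteq> ?F"
    then have "(\<lambda>\<sigma>. if \<sigma> \<in> T then 1 else 0) \<in> chains l K"
      by (auto simp: chains_def)
    moreover have "T = supp (\<lambda>\<sigma>. if \<sigma> \<in> T then 1 else 0)" by (auto simp: supp_def)
    ultimately show "T \<in> supp ` chains l K" by blast
  qed (auto simp: supp_def chains_def)
  have "finite (Pow ?F)" using assms by simp
  then show "finite (chains l K)"
    using img inj by (metis finite_imageD inj_on_subset subset_UNIV)
  have "card (chains l K) = card (supp ` chains l K)"
    using inj by (intro card_image[symmetric] inj_on_subset[OF inj]) simp
  also have "\<dots> = card (Pow ?F)" by (simp only: img)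
  finally show "card (chains l K) = 2 ^ card ?F" using assms by (simp add: card_Pow)
qed

lemma chain_dim_chains:
  assumes "finite K"
  shows "chain_dim (chains l K) = card {\<sigma> \<in> K. card \<sigma> = l + 1}"
proof -
  have "(2::nat) ^ chain_dim (chains l K) = 2 ^ card {\<sigma> \<in> K. card \<sigma> = l + 1}"
    using card_eq_power_chain_dim[OF subspace_chains card_chains(1)] card_chains(2) assms
    by (simp only:)
  then show ?thesis by simp
qed

lemma chain_dim_chains_full_simplex: "chain_dim (chains l (full_simplex N)) = N choose (l + 1)"
proof -
  have "{\<sigma> \<in> full_simplex N. card \<sigma> = l + 1} = {\<sigma>. \<sigma> \<subseteq> {1..N} \<and> card \<sigma> = l + 1}"
    by (auto simp: full_simplex_def)
  then show ?thesis using n_subsets[of "{1..N}" "l + 1"] by (simp add: chain_dim_chains)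
qed

lemma finite_cycles: "finite K \<Longrightarrow> finite (cycles l K)"
  using card_chains(1) by (auto simp: cycles_def)

lemma finite_boundaries: "finite K \<Longrightarrow> finite (boundaries l K)"
  using card_chains(1) by (auto simp: boundaries_def)

text \<open>\<open>boundaries\<close> makes sense for every family of sets, so closure under
  nonempty faces is what counts here. The empty face is excluded by the case distinction in
  \<open>boundary\<close>.\<close>

lemma boundaries_full_simplex_subset: "boundaries l (full_simplex N) \<subseteq> chains l (full_simplex N)"
proof
  fix b assume "b \<in> boundaries l (full_simplex N)"
  then obtain c where c: "c \<in> chains (l + 1) (full_simplex N)" "b = boundary (full_simplex N) c"
    by (auto simp: boundaries_def)
  have "\<tau> \<in> full_simplex N \<and> card \<tau> = l + 1" if "b \<tau> \<noteq> 0" for \<tau>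
  proof -
    have ne: "\<tau> \<noteq> {}" using that c by (auto simp: boundary_def)
    then have "(\<Sum>\<sigma> | \<sigma> \<in> full_simplex N \<and> (\<exists>v\<in>\<sigma>. \<tau> = \<sigma> - {v}). c \<sigma>) \<noteq> 0"
      using that c by (simp add: boundary_def)
    then obtain \<sigma> v where \<sigma>: "\<sigma> \<in> full_simplex N" "v \<in> \<sigma>" "\<tau> = \<sigma> - {v}" "c \<sigma> \<noteq> 0"
      by (rule sum.not_neutral_contains_not_neutral) blast
    have "card \<sigma> = l + 2" using \<sigma>(4) c(1) unfolding chains_def by simp
    then show ?thesis using \<sigma> ne by (auto simp: full_simplex_def)
  qed
  then show "b \<in> chains l (full_simplex N)" unfolding chains_def by blast
qed

lemma chain_dim_boundaries_full_simplex_le: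
  "chain_dim (boundaries l (full_simplex N)) \<le> min (N choose (l + 1)) (N choose (l + 2))"
proof -
  have "chain_dim (boundaries l (full_simplex N)) \<le> N choose (l + 1)"
    using chain_dim_mono[OF subspace_boundaries subspace_chains _ boundaries_full_simplex_subset]
    by (simp add: card_chains chain_dim_chains_full_simplex)
  \<comment> \<open>An image is no larger than its source; through cardinalities this bounds the
    dimension.\<close>
  moreover have "card (boundaries l (full_simplex N)) \<le> card (chains (l + 1) (full_simplex N))"
    unfolding boundaries_def by (intro card_image_le card_chains) simp
  then have "(2::nat) ^ chain_dim (boundaries l (full_simplex N))
      \<le> 2 ^ chain_dim (chains (l + 1) (full_simplex N))"
    by (simp only: card_eq_power_chain_dim[OF subspace_boundaries finite_boundaries]
        card_eq_power_chain_dim[OF subspace_chains card_chains(1)] finite_full_simplex)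
  then have "chain_dim (boundaries l (full_simplex N))
      \<le> chain_dim (chains (l + 1) (full_simplex N))"
    by simp
  then have "chain_dim (boundaries l (full_simplex N)) \<le> N choose (l + 2)"
    by (simp add: chain_dim_chains_full_simplex)
  ultimately show ?thesis by simp
qed

section \<open>Counting the finite pairs of the diagram\<close>

text \<open>
  The dimensions of the cycle spaces cancel in the multiplicity formula; what is left is the second
  difference of this rank.
\<close>

definition bounding_rank :: "nat \<Rightarrow> nat set set \<Rightarrow> nat set set \<Rightarrow> int" where
  "bounding_rank l K L = int (chain_dim (cycles l K \<inter> boundaries l L))"

lemma subspace_cycles_Int_boundaries: "chain.subspace (cycles l K \<inter> boundaries l L)"
  by (intro chain.subspace_inter subspace_cycles subspace_boundaries)

text \<open>The truncated subtraction in \<open>persistent_betti\<close> is exact, because the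
  subtracted space lies in the cycle space.\<close>

lemma persistent_betti_eq:
  assumes "finite K"
  shows "int (persistent_betti l K L) = int (chain_dim (cycles l K)) - bounding_rank l K L"
proof -
  have "chain_dim (cycles l K \<inter> boundaries l L) \<le> chain_dim (cycles l K)"
    using assms
    by (intro chain_dim_mono subspace_cycles_Int_boundaries subspace_cycles finite_cycles Int_lower1)
  then show ?thesis by (simp add: persistent_betti_def bounding_rank_def of_nat_diff)
qed

text \<open>The spaces for \<open>(K, L')\<close> and \<open>(K', L)\<close> both lie in the one for
  \<open>(K, L)\<close> and intersect exactly in the one for \<open>(K', L')\<close>, so
  \<open>chain_dim_modular_le\<close> applies.\<close>

lemma bounding_rank_supermodular:
  assumes "finite K" "finite L" "K' \<subseteq> K" "L' \<subseteq> L"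
  shows "bounding_rank l K L' + bounding_rank l K' L
    \<le> bounding_rank l K L + bounding_rank l K' L'"
proof -
  note mono = cycles_mono[OF assms(1,3), of l] boundaries_mono[OF assms(2,4), of l]
  have "finite (cycles l K \<inter> boundaries l L)" using finite_boundaries[OF assms(2)] by simp
  then have "chain_dim (cycles l K \<inter> boundaries l L') + chain_dim (cycles l K' \<inter> boundaries l L)
      \<le> chain_dim (cycles l K \<inter> boundaries l L)
        + chain_dim ((cycles l K \<inter> boundaries l L') \<inter> (cycles l K' \<inter> boundaries l L))"
    by (rule chain_dim_modular_le[OF subspace_cycles_Int_boundaries subspace_cycles_Int_boundaries
          subspace_cycles_Int_boundaries]) (use mono in blast)+
  also have "(cycles l K \<inter> boundaries l L') \<inter> (cycles l K' \<inter> boundaries l L)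
      = cycles l K' \<inter> boundaries l L'"
    using mono by blast
  finally show ?thesis by (simp add: bounding_rank_def)
qed

text \<open>The modular inequality again, now inside \<open>boundaries l L\<close>. The bound no
  longer mentions \<open>K\<close>, which is what makes it possible to sum over deaths.\<close>

lemma bounding_rank_diff_le:
  assumes "finite L" "L' \<subseteq> L"
  shows "bounding_rank l K L - bounding_rank l K L'
    \<le> int (chain_dim (boundaries l L)) - int (chain_dim (boundaries l L'))"
proof -
  note mono = boundaries_mono[OF assms, of l]
  have "chain_dim (cycles l K \<inter> boundaries l L) + chain_dim (boundaries l L')
      \<le> chain_dim (boundaries l L) + chain_dim ((cycles l K \<inter> boundaries l L) \<inter> boundaries l L')"
    by (rule chain_dim_modular_le[OF subspace_cycles_Int_boundaries subspace_boundaries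
          subspace_boundaries finite_boundaries[OF assms(1)]]) (use mono in blast)+
  also have "(cycles l K \<inter> boundaries l L) \<inter> boundaries l L' = cycles l K \<inter> boundaries l L'"
    using mono by blast
  finally show ?thesis by (simp add: bounding_rank_def)
qed

text \<open>Telescoping without enumerating the values: the strict sublevel set of a value is the
  sublevel set of its predecessor. A new maximum leaves the earlier summands unchanged.\<close>

lemma sum_telescope_finite_set:
  fixes V :: "real set" and F :: "real set \<Rightarrow> int"
  assumes "finite V"
  shows "(\<Sum>b\<in>V. F {v\<in>V. v \<le> b} - F {v\<in>V. v < b}) = F V - F {}"
  using assms
proof (induction V rule: finite_linorder_max_induct)
  case (insert x V)
  define g where "g = (\<lambda>b. F {v\<in>insert x V. v \<le> b} - F {v\<in>insert x V. v < b})"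
  have "{v \<in> insert x V. v \<le> x} = insert x V" "{v \<in> insert x V. v < x} = V"
    using insert.hyps by auto
  then have "g x = F (insert x V) - F V" by (simp only: g_def)
  moreover have "sum g V = (\<Sum>b\<in>V. F {v\<in>V. v \<le> b} - F {v\<in>V. v < b})"
    unfolding g_def using insert.hyps
    by (intro sum.cong arg_cong2[where f="(-)"] arg_cong[where f=F]) auto
  moreover have "x \<notin> V" using insert.hyps by auto
  ultimately have "sum g (insert x V) = F (insert x V) - F {}"
    using insert by simp
  then show ?case by (simp only: g_def)
qed auto

lemma finite_vr_values [simp]: "finite (vr_values N x)"
  by (simp add: vr_values_def)

lemma vr_multiplicity_finite_eq:
  "vr_multiplicity l N x b (ereal d) =
     (bounding_rank l (vr_le N x b) (vr_le N x d) - bounding_rank l (vr_less N x b) (vr_le N x d))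
   - (bounding_rank l (vr_le N x b) (vr_less N x d)
       - bounding_rank l (vr_less N x b) (vr_less N x d))"
  by (simp add: vr_multiplicity_def persistent_betti_eq vr_le_def vr_less_def)

lemma vr_multiplicity_finite_nonneg: "0 \<le> vr_multiplicity l N x b (ereal d)"
proof -
  have "finite (vr_le N x t)" "vr_less N x t \<subseteq> vr_le N x t" for t
    by (auto simp: vr_le_def vr_less_def)
  then have "bounding_rank l (vr_le N x b) (vr_less N x d)
      + bounding_rank l (vr_less N x b) (vr_le N x d)
      \<le> bounding_rank l (vr_le N x b) (vr_le N x d)
          + bounding_rank l (vr_less N x b) (vr_less N x d)"
    by (intro bounding_rank_supermodular)
  then show ?thesis by (simp add: vr_multiplicity_finite_eq)
qed

text \<open>The pairs that die at \<open>d\<close>, whatever their births, are at most as many as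
  the dimensions by which the boundary space grows at \<open>d\<close>.\<close>

lemma sum_vr_multiplicity_le:
  "(\<Sum>(b, d) \<in> {(b, d). b \<in> vr_values N x \<and> d \<in> vr_values N x \<and> b < d}.
      vr_multiplicity l N x b (ereal d)) \<le> int (min (N choose (l + 1)) (N choose (l + 2)))"
proof -
  define V where "V = vr_values N x"
  \<comment> \<open>Indexing complexes by sets of values brings both sums into the form of
    \<open>sum_telescope_finite_set\<close>.\<close>
  define C where "C = (\<lambda>S. {\<sigma> \<in> full_simplex N. vr_filtration x \<sigma> \<in> S})"
  define \<beta> where "\<beta> = (\<lambda>S. int (chain_dim (boundaries l (C S))))"
  have fin: "finite V" "finite (C S)" for S by (auto simp: V_def C_def)
  have le: "vr_le N x (ereal b) = C {v\<in>V. v \<le> b}" and less: "vr_less N x (ereal b) = C {v\<in>V. v < b}"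
      for b
    by (auto simp: vr_le_def vr_less_def C_def V_def vr_values_def)
  have inner: "(\<Sum>b\<in>{v\<in>V. v < d}. vr_multiplicity l N x b (ereal d))
      \<le> \<beta> {v\<in>V. v \<le> d} - \<beta> {v\<in>V. v < d}" for d
  proof -
    let ?V = "{v\<in>V. v < d}"
    define F where "F = (\<lambda>S. bounding_rank l (C S) (C {v\<in>V. v \<le> d}) - bounding_rank l (C S) (C ?V))"
    have sub: "C ?V \<subseteq> C {v\<in>V. v \<le> d}" by (auto simp: C_def)
    \<comment> \<open>Only births below \<open>d\<close> are summed; for these, discarding the
      values from \<open>d\<close> on changes neither sublevel set.\<close>
    have "vr_multiplicity l N x b (ereal d) = F {v\<in>?V. v \<le> b} - F {v\<in>?V. v < b}" if "b \<in> ?V" for b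
    proof -
      have "{v\<in>?V. v \<le> b} = {v\<in>V. v \<le> b}" "{v\<in>?V. v < b} = {v\<in>V. v < b}" using that by auto
      then show ?thesis by (simp only: F_def vr_multiplicity_finite_eq le less)
    qed
    then have "(\<Sum>b\<in>?V. vr_multiplicity l N x b (ereal d))
        = (\<Sum>b\<in>?V. F {v\<in>?V. v \<le> b} - F {v\<in>?V. v < b})"
      by (intro sum.cong refl)
    also have "\<dots> = F ?V - F {}"
      by (rule sum_telescope_finite_set) (simp add: fin)
    finally have "(\<Sum>b\<in>?V. vr_multiplicity l N x b (ereal d)) = F ?V - F {}" .
    moreover have "F ?V \<le> \<beta> {v\<in>V. v \<le> d} - \<beta> ?V"
      unfolding F_def \<beta>_def using bounding_rank_diff_le[OF fin(2) sub] .
    \<comment> \<open>The lower end of the telescoping sum is dropped, so only its sign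
      matters.\<close>
    moreover have "0 \<le> F {}"
    proof -
      have "cycles l (C {}) \<inter> boundaries l (C ?V) \<subseteq> cycles l (C {}) \<inter> boundaries l (C {v\<in>V. v \<le> d})"
        using boundaries_mono[OF fin(2) sub] by blast
      then show ?thesis
        unfolding F_def bounding_rank_def
        by (simp add: chain_dim_mono subspace_cycles subspace_boundaries chain.subspace_inter
            finite_cycles fin)
    qed
    ultimately show ?thesis by linarith
  qed
  have "{(b, d). b \<in> V \<and> d \<in> V \<and> b < d} = prod.swap ` (SIGMA d:V. {v\<in>V. v < d})" by auto
  then have "(\<Sum>(b, d) \<in> {(b, d). b \<in> V \<and> d \<in> V \<and> b < d}. vr_multiplicity l N x b (ereal d))
      = (\<Sum>(d, b) \<in> (SIGMA d:V. {v\<in>V. v < d}). vr_multiplicity l N x b (ereal d))"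
    by (simp add: sum.reindex case_prod_beta)
  also have "\<dots> = (\<Sum>d\<in>V. \<Sum>b\<in>{v\<in>V. v < d}. vr_multiplicity l N x b (ereal d))"
    using fin by (intro sum.Sigma[symmetric]) auto
  also have "\<dots> \<le> (\<Sum>d\<in>V. \<beta> {v\<in>V. v \<le> d} - \<beta> {v\<in>V. v < d})"
    by (intro sum_mono inner)
  also have "\<dots> = \<beta> V - \<beta> {}" using fin by (intro sum_telescope_finite_set)
  also have "\<dots> \<le> \<beta> V" by (simp add: \<beta>_def)
  also have "C V = full_simplex N" by (auto simp: C_def V_def vr_values_def)
  then have "\<beta> V \<le> int (min (N choose (l + 1)) (N choose (l + 2)))"
    unfolding \<beta>_def using chain_dim_boundaries_full_simplex_le[of l N] by simp
  finally show ?thesis by (simp add: V_def)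
qed

section \<open>The persistence functionals as a sum and a maximum over pairs of values\<close>

lemma sum_image_filter_mset_sum:
  fixes h :: "'a \<Rightarrow> real"
  shows "finite A \<Longrightarrow> (\<Sum>q \<in># filter_mset P (\<Sum>a\<in>A. f a). h q) = (\<Sum>a\<in>A. \<Sum>q \<in># filter_mset P (f a). h q)"
  by (induction A rule: finite_induct) simp_all

lemma sum_image_filter_mset_replicate:
  fixes h :: "'a \<Rightarrow> real"
  shows "(\<Sum>q \<in># filter_mset P (replicate_mset n a). h q) = (if P a then real n * h a else 0)"
  by (induction n) (simp_all add: distrib_right)

text \<open>Multiplicities of finite pairs are nonnegative, so the conversion by \<open>nat\<close>
  in \<open>vr_diagram\<close> loses nothing.\<close>

lemma total_persistence_eq:
  "total_persistence l N x =
     (\<Sum>(b, d) \<in> {(b, d). b \<in> vr_values N x \<and> d \<in> vr_values N x \<and> b < d}.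
        real_of_int (vr_multiplicity l N x b (ereal d)) * (d - b))"
proof -
  define V where "V = vr_values N x"
  let ?P = "{(b, d). b \<in> V \<and> d \<in> insert \<infinity> (ereal ` V) \<and> ereal b < d}"
  let ?Q = "{(b, d). b \<in> V \<and> d \<in> V \<and> b < d}"
  define m where "m = (\<lambda>(b, d). nat (vr_multiplicity l N x b d))"
  have fin: "finite ?P"
    by (rule finite_subset[of _ "V \<times> insert \<infinity> (ereal ` V)"]) (auto simp: V_def)
  have "total_persistence l N x
      = (\<Sum>q\<in>?P. \<Sum>q' \<in># filter_mset (\<lambda>(b, d). d < \<infinity>) (replicate_mset (m q) q). lifetime q')"
    unfolding total_persistence_def finite_pairs_def vr_diagram_def
    by (subst sum_image_filter_mset_sum)
      (use fin in \<open>auto simp: V_def m_def intro!: sum.cong\<close>)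
  also have "\<dots> = (\<Sum>q\<in>?P. if snd q < \<infinity> then real (m q) * lifetime q else 0)"
    unfolding sum_image_filter_mset_replicate by (simp add: case_prod_beta)
  also have "\<dots> = (\<Sum>q\<in>(\<lambda>(b, d). (b, ereal d)) ` ?Q. real (m q) * lifetime q)"
    by (rule sum.mono_neutral_cong_right) (use fin in auto)
  also have "\<dots> = (\<Sum>q\<in>?Q.
      real_of_int (vr_multiplicity l N x (fst q) (ereal (snd q))) * (snd q - fst q))"
    by (subst sum.reindex)
      (auto simp: inj_on_def m_def lifetime_def vr_multiplicity_finite_nonneg intro!: sum.cong)
  finally show ?thesis by (simp add: V_def case_prod_beta)
qed

lemma set_finite_pairs_vr_diagram:
  "set_mset (finite_pairs (vr_diagram l N x)) = (\<lambda>(b, d). (b, ereal d)) `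
     {(b, d). b \<in> vr_values N x \<and> d \<in> vr_values N x \<and> b < d
         \<and> 0 < vr_multiplicity l N x b (ereal d)}"
proof -
  have fin: "finite {(b, d). b \<in> vr_values N x \<and> d \<in> insert \<infinity> (ereal ` vr_values N x)
      \<and> ereal b < d}"
    by (rule finite_subset[of _ "vr_values N x \<times> insert \<infinity> (ereal ` vr_values N x)"]) auto
  show ?thesis
    unfolding finite_pairs_def vr_diagram_def set_mset_filter set_mset_sum[OF fin]
    apply (auto split: if_splits simp: image_iff)
    subgoal for b d by (rule exI[of _ b], simp, rule exI[of _ "ereal d"], force)
    done
qed

text \<open>All lifetimes in the diagram are positive, so inserting 0 affects the maximum only when
  there is no finite pair, where it yields the default value.\<close>

lemma max_persistence_eq:
  "max_persistence l N x = Max (insert 0 ((\<lambda>(b, d).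
       if b < d \<and> 0 < vr_multiplicity l N x b (ereal d) then d - b else 0) `
        (vr_values N x \<times> vr_values N x)))"
  (is "_ = Max (insert 0 (?f ` ?V))")
proof -
  define D where "D = finite_pairs (vr_diagram l N x)"
  have D: "set_mset D = (\<lambda>(b, d). (b, ereal d)) `
     {(b, d). b \<in> vr_values N x \<and> d \<in> vr_values N x \<and> b < d
         \<and> 0 < vr_multiplicity l N x b (ereal d)}"
    unfolding D_def by (rule set_finite_pairs_vr_diagram)
  let ?Q = "{(b, d). b \<in> vr_values N x \<and> d \<in> vr_values N x \<and> b < d
      \<and> 0 < vr_multiplicity l N x b (ereal d)}"
  have lifetimes: "lifetime ` set_mset D = ?f ` ?Q"
    unfolding D image_image by (intro image_cong) (auto simp: lifetime_def)
  \<comment> \<open>Pairs of values absent from the diagram contribute only 0, which is inserted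
    anyway.\<close>
  have insert_Un: "insert 0 (P \<union> R) = insert 0 P" if "R \<subseteq> {0}" for P R :: "real set"
    using that by blast
  have "?V = ?Q \<union> (?V - ?Q)" by blast
  then have "?f ` ?V = ?f ` ?Q \<union> ?f ` (?V - ?Q)" by (metis image_Un)
  moreover have "?f ` (?V - ?Q) \<subseteq> {0}" by (auto split: if_splits)
  ultimately have eq: "insert 0 (?f ` ?V) = insert 0 (lifetime ` set_mset D)"
    by (simp only: lifetimes insert_Un)
  have pos: "0 < t" if "t \<in> lifetime ` set_mset D" for t
    using that unfolding D by (auto simp: lifetime_def)
  show ?thesis
  proof (cases "D = {#}")
    case True
    then show ?thesis unfolding eq by (simp add: max_persistence_def D_def)
  next
    case False
    then have ne: "lifetime ` set_mset D \<noteq> {}" by simp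
    then have "0 < Max (lifetime ` set_mset D)" using pos by (simp add: Max_gr_iff ex_in_conv)
    then have "Max (insert 0 (lifetime ` set_mset D)) = Max (lifetime ` set_mset D)"
      using ne by (simp add: Max_insert)
    then show ?thesis unfolding eq using False by (simp add: max_persistence_def D_def)
  qed
qed

lemma total_persistence_nonneg: "0 \<le> total_persistence l N x"
  unfolding total_persistence_eq by (intro sum_nonneg) (auto simp: vr_multiplicity_finite_nonneg)

lemma max_persistence_nonneg: "0 \<le> max_persistence l N x"
  unfolding max_persistence_eq by (intro Max_ge) auto

text \<open>A pair that occurs has multiplicity at least 1, so its lifetime is bounded by a single
  summand of the total.\<close>

lemma max_persistence_le_total: "max_persistence l N x \<le> total_persistence l N x"
proof -
  let ?Q = "{(b, d). b \<in> vr_values N x \<and> d \<in> vr_values N x \<and> b < d}"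
  have fin: "finite ?Q"
    by (rule finite_subset[of _ "vr_values N x \<times> vr_values N x"]) auto
  have "d - b \<le> total_persistence l N x"
    if "b \<in> vr_values N x" "d \<in> vr_values N x" "b < d" "0 < vr_multiplicity l N x b (ereal d)"
        for b d
  proof -
    have "1 * (d - b) \<le> real_of_int (vr_multiplicity l N x b (ereal d)) * (d - b)"
      using that by (intro mult_right_mono) auto
    also have "\<dots> = (\<lambda>(b, d). real_of_int (vr_multiplicity l N x b (ereal d)) * (d - b)) (b, d)"
        by simp
    also have "\<dots> \<le> total_persistence l N x"
      unfolding total_persistence_eq using that fin
      by (intro member_le_sum) (auto simp: vr_multiplicity_finite_nonneg)
    finally show ?thesis by simp
  qed
  then show ?thesis
    unfolding max_persistence_eq by (auto simp: total_persistence_nonneg)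
qed

section \<open>Bounds in terms of the largest norm of a point\<close>

lemma vr_filtration_bounds:
  assumes "\<sigma> \<in> full_simplex N" "\<And>i. i \<in> {1..N} \<Longrightarrow> norm (x i) \<le> r"
  shows "0 \<le> vr_filtration x \<sigma>" "vr_filtration x \<sigma> \<le> 2 * r"
proof -
  let ?S = "{norm (x i - x j) | i j. i \<in> \<sigma> \<and> j \<in> \<sigma>}"
  have \<sigma>: "finite \<sigma>" "\<sigma> \<noteq> {}" "\<sigma> \<subseteq> {1..N}"
    using assms(1) finite_subset[of \<sigma> "{1..N}"] by (auto simp: full_simplex_def)
  have "?S = (\<lambda>(i, j). norm (x i - x j)) ` (\<sigma> \<times> \<sigma>)" by auto
  then have fin: "finite ?S" using \<sigma> by simp
  obtain i where "i \<in> \<sigma>" using \<sigma> by auto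
  then have ne: "norm (x i - x i) \<in> ?S" by blast
  then show "0 \<le> vr_filtration x \<sigma>"
    unfolding vr_filtration_def using Max_ge[OF fin ne] by simp
  have "norm (x i - x j) \<le> 2 * r" if "i \<in> \<sigma>" "j \<in> \<sigma>" for i j
    using norm_triangle_ineq4[of "x i" "x j"] assms(2)[of i] assms(2)[of j] that \<sigma>(3) by force
  then show "vr_filtration x \<sigma> \<le> 2 * r"
    unfolding vr_filtration_def using fin ne by (subst Max_le_iff) auto
qed

lemma total_persistence_le:
  assumes "\<And>i. i \<in> {1..N} \<Longrightarrow> norm (x i) \<le> r"
  shows "total_persistence l N x \<le> 2 * r * real (min (N choose (l + 1)) (N choose (l + 2)))"
proof -
  let ?Q = "{(b, d). b \<in> vr_values N x \<and> d \<in> vr_values N x \<and> b < d}"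
  have le: "d - b \<le> 2 * r" "0 \<le> 2 * r" if bd: "(b, d) \<in> ?Q" for b d
  proof -
    obtain \<sigma> \<tau> where "\<sigma> \<in> full_simplex N" "b = vr_filtration x \<sigma>"
      "\<tau> \<in> full_simplex N" "d = vr_filtration x \<tau>"
      using bd unfolding vr_values_def by blast
    then have "0 \<le> b" "0 \<le> d" "d \<le> 2 * r" using vr_filtration_bounds[OF _ assms] by auto
    then show "d - b \<le> 2 * r" "0 \<le> 2 * r" by auto
  qed
  have "total_persistence l N x
      \<le> (\<Sum>(b, d)\<in>?Q. real_of_int (vr_multiplicity l N x b (ereal d)) * (2 * r))"
    unfolding total_persistence_eq using le
    by (intro sum_mono) (auto intro!: mult_left_mono simp: vr_multiplicity_finite_nonneg)
  also have "\<dots> = 2 * r * real_of_int (\<Sum>(b, d)\<in>?Q. vr_multiplicity l N x b (ereal d))"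
    by (simp add: sum_distrib_left sum_distrib_right case_prod_beta mult.commute)
  also have "\<dots> \<le> 2 * r * real (min (N choose (l + 1)) (N choose (l + 2)))"
  \<comment> \<open>Monotonicity of multiplication needs \<open>0 \<le> r\<close>. A pair of values
    supplies it; without pairs it comes from any point, and for \<open>N = 0\<close> both sides are
    0.\<close>
  proof (cases "?Q = {}")
    case True
    show ?thesis
    proof (cases "N = 0")
      case True
      then show ?thesis by (simp add: vr_values_def full_simplex_def)
    next
      case False
      then have "norm (x 1) \<le> r" by (intro assms) simp
      then have "0 \<le> r" using norm_ge_zero order_trans by blast
      then show ?thesis using True by (simp only: sum.empty) simp
    qed
  next
    case False
    then have "0 \<le> 2 * r" using le(2) by auto
    moreover have "real_of_int (\<Sum>(b, d)\<in>?Q. vr_multiplicity l N x b (ereal d))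
        \<le> real_of_int (int (min (N choose (l + 1)) (N choose (l + 2))))"
      unfolding of_int_le_iff by (rule sum_vr_multiplicity_le)
    ultimately show ?thesis unfolding of_int_of_nat_eq by (intro mult_left_mono)
  qed
  finally show ?thesis .
qed

section \<open>Measurability of the persistence functionals\<close>

text \<open>A random subset of a finite set takes finitely many values, and the event of a given
  value is a finite intersection of membership events and their complements.\<close>

lemma measurable_finite_Collect:
  assumes "finite F" and [measurable]: "\<And>\<tau>. \<tau> \<in> F \<Longrightarrow> Measurable.pred M (P \<tau>)"
  shows "(\<lambda>\<omega>. {\<tau> \<in> F. P \<tau> \<omega>}) \<in> measurable M (count_space UNIV)"
proof -
  have "(\<lambda>\<omega>. {\<tau> \<in> F. P \<tau> \<omega>}) \<in> measurable M (count_space (Pow F))"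
  proof (subst measurable_count_space_eq2, intro finite_Pow_iff[THEN iffD2] assms(1), intro conjI
      ballI)
    fix A assume A: "A \<in> Pow F"
    have "Measurable.pred M (\<lambda>\<omega>. \<forall>\<tau>\<in>F. P \<tau> \<omega> \<longleftrightarrow> \<tau> \<in> A)"
      using assms(1) by measurable
    moreover have "(\<lambda>\<omega>. {\<tau> \<in> F. P \<tau> \<omega>}) -` {A} \<inter> space M = {\<omega> \<in> space M. \<forall>\<tau>\<in>F. P \<tau> \<omega> \<longleftrightarrow> \<tau> \<in> A}"
      using A by auto
    ultimately show "(\<lambda>\<omega>. {\<tau> \<in> F. P \<tau> \<omega>}) -` {A} \<inter> space M \<in> sets M"
      by (simp add: pred_def)
  qed auto
  then show ?thesis by (rule measurable_compose[where g="\<lambda>A. A"]) simp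
qed

lemma borel_measurable_vr_filtration:
  fixes X :: "nat \<Rightarrow> 'w \<Rightarrow> 'a::{second_countable_topology, real_normed_vector}"
  assumes X: "\<And>i. i \<in> {1..N} \<Longrightarrow> X i \<in> borel_measurable M" and \<sigma>: "\<sigma> \<in> full_simplex N"
  shows "(\<lambda>\<omega>. vr_filtration (\<lambda>i. X i \<omega>) \<sigma>) \<in> borel_measurable M"
proof -
  have fin: "finite \<sigma>" and sub: "\<sigma> \<subseteq> {1..N}"
    using \<sigma> finite_subset[of \<sigma> "{1..N}"] by (auto simp: full_simplex_def)
  have "{norm (X i \<omega> - X j \<omega>) | i j. i \<in> \<sigma> \<and> j \<in> \<sigma>}
      = (\<lambda>q. norm (X (fst q) \<omega> - X (snd q) \<omega>)) ` (\<sigma> \<times> \<sigma>)" for \<omega>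
    by force
  moreover have "(\<lambda>\<omega>. Max ((\<lambda>q. norm (X (fst q) \<omega> - X (snd q) \<omega>)) ` (\<sigma> \<times> \<sigma>))) \<in> borel_measurable M"
    using fin sub X
    by (intro borel_measurable_Max borel_measurable_norm[THEN measurable_compose[rotated]]
        borel_measurable_diff) auto
  ultimately show ?thesis unfolding vr_filtration_def by simp
qed

text \<open>Trades an index set that may vary with the outcome for a fixed one: each term of the
  image is shared equally among its preimages.\<close>

lemma sum_image_eq_weighted_sum:
  fixes h :: "'b \<Rightarrow> real"
  assumes "finite S"
  shows "(\<Sum>y\<in>f ` S. h y) = (\<Sum>q\<in>S. h (f q) / real (card {q' \<in> S. f q' = f q}))"
proof -
  have "(\<Sum>q | q \<in> S \<and> f q = y. h (f q) / real (card {q' \<in> S. f q' = f q})) = h y" if "y \<in> f ` S"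
      for y
  proof -
    have "card {q' \<in> S. f q' = y} \<noteq> 0" using that assms by auto
    moreover have "(\<Sum>q | q \<in> S \<and> f q = y. h (f q) / real (card {q' \<in> S. f q' = f q}))
        = (\<Sum>q | q \<in> S \<and> f q = y. h y / real (card {q' \<in> S. f q' = y}))"
      by (intro sum.cong) auto
    ultimately show ?thesis by simp
  qed
  then show ?thesis by (subst sum.image_gen[OF assms, of _ f]) (simp cong: sum.cong)
qed

text \<open>
  The multiplicity of a pair of filtration values depends only on the preorder which the filtration
  induces on the simplices. This preorder is a random variable with finitely many values.
\<close>

definition vr_preorder :: "nat \<Rightarrow> (nat \<Rightarrow> 'a::real_normed_vector) \<Rightarrow> (nat set \<times> nat set) set" where
  "vr_preorder N x = {q \<in> full_simplex N \<times> full_simplex N.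
      vr_filtration x (fst q) \<le> vr_filtration x (snd q)}"

text \<open>As filtration values are totally ordered, \<open>(\<sigma>, \<rho>) \<notin> R\<close>
  says that \<open>\<rho>\<close> comes strictly before \<open>\<sigma>\<close>. Pairs whose values
  do not strictly increase are no candidates for the diagram and get 0.\<close>

definition preorder_multiplicity ::
  "nat \<Rightarrow> nat \<Rightarrow> nat set \<Rightarrow> nat set \<Rightarrow> (nat set \<times> nat set) set \<Rightarrow> int" where
  "preorder_multiplicity l N \<sigma> \<tau> R =
     (let le = (\<lambda>\<sigma>. {\<rho> \<in> full_simplex N. (\<rho>, \<sigma>) \<in> R}); less = (\<lambda>\<sigma>. {\<rho> \<in> full_simplex N. (\<sigma>, \<rho>) \<notin> R})
      in if (\<tau>, \<sigma>) \<in> R then 0 else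
        int (persistent_betti l (le \<sigma>) (less \<tau>)) - int (persistent_betti l (less \<sigma>) (less \<tau>))
        - (int (persistent_betti l (le \<sigma>) (le \<tau>)) - int (persistent_betti l (less \<sigma>) (le \<tau>))))"

lemma preorder_multiplicity_eq:
  assumes "\<sigma> \<in> full_simplex N" "\<tau> \<in> full_simplex N"
  shows "preorder_multiplicity l N \<sigma> \<tau> (vr_preorder N x) =
    (if vr_filtration x \<sigma> < vr_filtration x \<tau>
     then vr_multiplicity l N x (vr_filtration x \<sigma>) (ereal (vr_filtration x \<tau>)) else 0)"
proof -
  have "{\<rho> \<in> full_simplex N. (\<rho>, \<sigma>') \<in> vr_preorder N x} = vr_le N x (vr_filtration x \<sigma>')"
    "{\<rho> \<in> full_simplex N. (\<sigma>', \<rho>) \<notin> vr_preorder N x} = vr_less N x (vr_filtration x \<sigma>')"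
    if "\<sigma>' \<in> full_simplex N" for \<sigma>'
    using that by (auto simp: vr_preorder_def vr_le_def vr_less_def)
  moreover have "(\<tau>, \<sigma>) \<in> vr_preorder N x \<longleftrightarrow> \<not> vr_filtration x \<sigma> < vr_filtration x \<tau>"
    using assms by (auto simp: vr_preorder_def)
  ultimately show ?thesis
    using assms by (simp add: preorder_multiplicity_def vr_multiplicity_def)
qed

lemma vr_values_Times:
  "vr_values N x \<times> vr_values N x
    = (\<lambda>q. (vr_filtration x (fst q), vr_filtration x (snd q))) ` (full_simplex N \<times> full_simplex N)"
  by (force simp: vr_values_def)

text \<open>
  Summing over pairs of simplices instead of pairs of values counts every pair of values as often
  as it is attained; the cardinality in the denominator corrects this.
\<close>

lemma total_persistence_eq_preorder:
  "total_persistence l N x = (\<Sum>q\<in>full_simplex N \<times> full_simplex N.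
     real_of_int (preorder_multiplicity l N (fst q) (snd q) (vr_preorder N x))
       / real (card {q' \<in> full_simplex N \<times> full_simplex N.
           (fst q', fst q) \<in> vr_preorder N x \<and> (fst q, fst q') \<in> vr_preorder N x
           \<and> (snd q', snd q) \<in> vr_preorder N x \<and> (snd q, snd q') \<in> vr_preorder N x})
       * (vr_filtration x (snd q) - vr_filtration x (fst q)))"
  (is "_ = (\<Sum>q\<in>?F. ?m q / real (card (?C q)) * ?d q)")
proof -
  let ?\<phi> = "\<lambda>q. (vr_filtration x (fst q), vr_filtration x (snd q))"
  define h where "h = (\<lambda>(b, d). if b < d
      then real_of_int (vr_multiplicity l N x b (ereal d)) * (d - b) else 0)"
  have "total_persistence l N x = (\<Sum>q\<in>vr_values N x \<times> vr_values N x. h q)"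
    unfolding total_persistence_eq
        by (rule sum.mono_neutral_cong_left) (auto simp: h_def split: if_splits)
  also have "\<dots> = (\<Sum>q\<in>?F. h (?\<phi> q) / real (card {q' \<in> ?F. ?\<phi> q' = ?\<phi> q}))"
    unfolding vr_values_Times by (rule sum_image_eq_weighted_sum) simp
  also have "\<dots> = (\<Sum>q\<in>?F. ?m q / real (card (?C q)) * ?d q)"
  proof (intro sum.cong refl)
    fix q assume q: "q \<in> ?F"
    \<comment> \<open>Equality of values is comparability in both directions, so the cardinality is
      a function of the preorder.\<close>
    then have "{q' \<in> ?F. ?\<phi> q' = ?\<phi> q} = ?C q"
      by (auto simp: vr_preorder_def intro: antisym)
    moreover have "h (?\<phi> q) = ?m q * ?d q"
      using q by (auto simp: h_def preorder_multiplicity_eq)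
    ultimately show "h (?\<phi> q) / real (card {q' \<in> ?F. ?\<phi> q' = ?\<phi> q})
        = ?m q / real (card (?C q)) * ?d q"
      by simp
  qed
  finally show ?thesis .
qed

text \<open>A maximum ignores repetitions, so here no correction by cardinalities appears.\<close>

lemma max_persistence_eq_preorder:
  "max_persistence l N x = Max (insert 0 ((\<lambda>q.
     if 0 < preorder_multiplicity l N (fst q) (snd q) (vr_preorder N x)
     then vr_filtration x (snd q) - vr_filtration x (fst q)
         else 0) ` (full_simplex N \<times> full_simplex N)))"
  unfolding max_persistence_eq vr_values_Times image_image
  by (intro arg_cong[where f=Max] arg_cong2[where f=insert] image_cong refl)
    (auto simp: preorder_multiplicity_eq split: if_splits)

context
  fixes X :: "nat \<Rightarrow> 'w \<Rightarrow> 'a::{second_countable_topology, real_normed_vector}"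
    and M :: "'w measure" and N :: nat
  assumes X: "\<And>i. i \<in> {1..N} \<Longrightarrow> X i \<in> borel_measurable M"
begin

lemma measurable_vr_preorder [measurable]:
  "(\<lambda>\<omega>. vr_preorder N (\<lambda>i. X i \<omega>)) \<in> measurable M (count_space UNIV)"
  unfolding vr_preorder_def
proof (rule measurable_finite_Collect)
  fix q assume "q \<in> full_simplex N \<times> full_simplex N"
  then have [measurable]: "(\<lambda>\<omega>. vr_filtration (\<lambda>i. X i \<omega>) (fst q)) \<in> borel_measurable M"
    "(\<lambda>\<omega>. vr_filtration (\<lambda>i. X i \<omega>) (snd q)) \<in> borel_measurable M"
    by (auto intro: borel_measurable_vr_filtration X)
  show "Measurable.pred M (\<lambda>\<omega>. vr_filtration (\<lambda>i. X i \<omega>) (fst q)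
      \<le> vr_filtration (\<lambda>i. X i \<omega>) (snd q))"
    by measurable
qed simp

lemma borel_measurable_of_vr_preorder:
  "(\<lambda>\<omega>. g (vr_preorder N (\<lambda>i. X i \<omega>)) :: real) \<in> borel_measurable M"
  by (rule measurable_compose[OF measurable_vr_preorder]) simp

lemma borel_measurable_total_persistence:
  "(\<lambda>\<omega>. total_persistence l N (\<lambda>i. X i \<omega>)) \<in> borel_measurable M"
  unfolding total_persistence_eq_preorder
  by (intro borel_measurable_sum borel_measurable_times borel_measurable_diff
      borel_measurable_of_vr_preorder borel_measurable_vr_filtration X) auto

lemma borel_measurable_max_persistence:
  "(\<lambda>\<omega>. max_persistence l N (\<lambda>i. X i \<omega>)) \<in> borel_measurable M"
proof -
  let ?F = "full_simplex N \<times> full_simplex N"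
  let ?f = "\<lambda>q \<omega>. if 0 < preorder_multiplicity l N (fst q) (snd q) (vr_preorder N (\<lambda>i. X i \<omega>))
     then vr_filtration (\<lambda>i. X i \<omega>) (snd q) - vr_filtration (\<lambda>i. X i \<omega>) (fst q) else 0"
  have meas: "?f q \<in> borel_measurable M" if "q \<in> ?F" for q
  proof -
    have [measurable]: "(\<lambda>\<omega>. vr_filtration (\<lambda>i. X i \<omega>) (fst q)) \<in> borel_measurable M"
      "(\<lambda>\<omega>. vr_filtration (\<lambda>i. X i \<omega>) (snd q)) \<in> borel_measurable M"
      using that by (auto intro: borel_measurable_vr_filtration X)
    have [measurable]: "Measurable.pred M (\<lambda>\<omega>. 0 < preorder_multiplicity l N (fst q) (snd q)
        (vr_preorder N (\<lambda>i. X i \<omega>)))"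
      by (rule measurable_compose[OF measurable_vr_preorder]) simp
    show ?thesis by measurable
  qed
  \<comment> \<open>For \<open>N = 0\<close> there are no pairs of simplices and the functional is
    constantly 0; otherwise the maximum runs over a fixed nonempty set.\<close>
  show ?thesis
  proof (cases "?F = {}")
    case False
    then have "max_persistence l N (\<lambda>i. X i \<omega>) = max 0 (Max ((\<lambda>q. ?f q \<omega>) ` ?F))" for \<omega>
      unfolding max_persistence_eq_preorder by (subst Max_insert) auto
    then show ?thesis using meas
        by (simp only:) (intro borel_measurable_max borel_measurable_Max; simp)
  qed (simp add: max_persistence_eq_preorder)
qed

end

section \<open>Square roots of positive semidefinite matrices\<close>

text \<open>Near \<open>t = 0\<close> the linear term dominates and changes sign unless
  \<open>a = 0\<close>.\<close>

lemma nonneg_quadratic_vanishing: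
  fixes a b :: real
  assumes "\<And>t. 0 \<le> 2 * t * a + t\<^sup>2 * b"
  shows "a = 0"
proof (rule ccontr)
  assume "a \<noteq> 0"
  \<comment> \<open>The minimiser after replacing \<open>b\<close> by the larger, strictly positive
    \<open>\<bar>b\<bar> + 1\<close>.\<close>
  define t where "t = - a / (\<bar>b\<bar> + 1)"
  have "2 * t * a + t\<^sup>2 * b \<le> 2 * t * a + t\<^sup>2 * (\<bar>b\<bar> + 1)"
    by (intro add_left_mono mult_left_mono) auto
  also have "\<dots> = t * (2 * a + t * (\<bar>b\<bar> + 1))"
    by (simp add: power2_eq_square algebra_simps)
  also have "t * (\<bar>b\<bar> + 1) = - a"
    by (simp add: t_def)
  also have "t * (2 * a + - a) = - (a\<^sup>2 / (\<bar>b\<bar> + 1))"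
    by (simp add: t_def power2_eq_square)
  also have "\<dots> < 0" using \<open>a \<noteq> 0\<close> by (simp add: divide_pos_pos add_nonneg_pos)
  finally show False using assms[of t] by simp
qed

text \<open>A maximiser of the Rayleigh quotient on the unit sphere of the subspace is an eigenvector.\<close>

lemma selfadjoint_eigenvector_exists:
  fixes f :: "'a::euclidean_space \<Rightarrow> 'a"
  assumes lin: "linear f" and sa: "\<And>x y. f x \<bullet> y = x \<bullet> f y"
    and S: "subspace S" and inv: "f ` S \<subseteq> S" and ne: "S \<noteq> {0}"
  obtains v c where "v \<in> S" "norm v = 1" "f v = c *\<^sub>R v"
proof -
  interpret linear f by fact
  define U where "U = S \<inter> sphere 0 1"
  obtain x where x: "x \<in> S" "x \<noteq> 0"
    using ne subspace_0[OF S] by auto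
  then have "(1 / norm x) *\<^sub>R x \<in> U"
    using S by (auto simp: U_def intro: subspace_scale)
  then have "U \<noteq> {}" by auto
  moreover have "compact U"
    unfolding U_def using closed_subspace[OF S] by (intro closed_Int_compact) auto
  moreover have "continuous_on U (\<lambda>x. x \<bullet> f x)"
    using linear_continuous_on[OF lin[unfolded linear_conv_bounded_linear]]
    by (intro continuous_intros)
  ultimately obtain v where v: "v \<in> U" "\<And>x. x \<in> U \<Longrightarrow> x \<bullet> f x \<le> v \<bullet> f v"
    using continuous_attains_sup by metis
  define c where "c = v \<bullet> f v"
  have vS: "v \<in> S" "norm v = 1" "v \<bullet> v = 1" using v(1) by (auto simp: U_def dot_square_norm)
  \<comment> \<open>Maximality on unit vectors extends to all of \<open>S\<close>, as both terms are
    homogeneous of degree two.\<close>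
  have nonneg: "0 \<le> c * (x \<bullet> x) - x \<bullet> f x" if "x \<in> S" for x
  proof (cases "x = 0")
    case False
    then have "(1 / norm x) *\<^sub>R x \<in> U"
      using S that by (auto simp: U_def intro: subspace_scale)
    from v(2)[OF this] have "(x \<bullet> f x) / (norm x)\<^sup>2 \<le> c"
      by (simp add: scale c_def power2_eq_square)
    then show ?thesis using False
        by (simp add: divide_simps dot_square_norm mult.commute split: if_splits)
  qed (simp add: zero)
  define u where "u = c *\<^sub>R v - f v"
  have uS: "u \<in> S" using vS inv S by (auto simp: u_def intro!: subspace_diff subspace_scale)
  \<comment> \<open>This is \<open>nonneg\<close> at \<open>v + t *\<^sub>R u\<close>: the constant
    term vanishes by the choice of \<open>c\<close>, and the linear coefficient is
    \<open>u \<bullet> u\<close>, so the residual \<open>u\<close> must be 0.\<close>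
  have "0 \<le> 2 * t * (u \<bullet> u) + t\<^sup>2 * (c * (u \<bullet> u) - u \<bullet> f u)" for t
  proof -
    have "v + t *\<^sub>R u \<in> S" using vS uS S by (auto intro!: subspace_add subspace_scale)
    from nonneg[OF this]
    have "0 \<le> (c * (v \<bullet> v) - v \<bullet> f v) + 2 * t * (c * (v \<bullet> u) - f v \<bullet> u)
        + t\<^sup>2 * (c * (u \<bullet> u) - u \<bullet> f u)"
      using sa[of u v]
      by (simp add: add scale inner_add_left inner_add_right sa inner_commute algebra_simps
          power2_eq_square)
    moreover have "c * (v \<bullet> v) - v \<bullet> f v = 0" using vS by (simp add: c_def)
    moreover have "c * (v \<bullet> u) - f v \<bullet> u = u \<bullet> u" by (simp add: u_def inner_diff_left)
    ultimately show ?thesis by simp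
  qed
  then have "u \<bullet> u = 0" by (rule nonneg_quadratic_vanishing)
  then have "f v = c *\<^sub>R v" by (simp add: u_def)
  then show thesis using that vS by blast
qed

text \<open>Stated for invariant subspaces to allow induction on the dimension: by self-adjointness,
  the orthogonal complement of an eigenvector within \<open>S\<close> is again invariant.\<close>

lemma selfadjoint_orthonormal_eigenbasis:
  fixes f :: "'a::euclidean_space \<Rightarrow> 'a"
  assumes lin: "linear f" and sa: "\<And>x y. f x \<bullet> y = x \<bullet> f y"
    and S: "subspace S" and inv: "f ` S \<subseteq> S"
  shows "\<exists>B. finite B \<and> B \<subseteq> S \<and> S \<subseteq> span B \<and> pairwise orthogonal B \<and> (\<forall>b\<in>B. norm b = 1)
    \<and> (\<forall>b\<in>B. \<exists>c. f b = c *\<^sub>R b)"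
  using S inv
proof (induction "dim S" arbitrary: S rule: less_induct)
  case (less S)
  show ?case
  proof (cases "S = {0}")
    case True
    then show ?thesis by (intro exI[of _ "{}"]) auto
  next
    case False
    obtain v c where v: "v \<in> S" "norm v = 1" "f v = c *\<^sub>R v"
      using selfadjoint_eigenvector_exists[OF lin sa less.prems False] by blast
    define T where "T = S \<inter> {x. v \<bullet> x = 0}"
    have T: "subspace T"
      unfolding T_def using less.prems(1) subspace_hyperplane by (rule subspace_inter)
    have invT: "f ` T \<subseteq> T"
      using less.prems(2) v(3) by (auto simp: T_def sa[symmetric])
    have vv: "v \<bullet> v = 1" using v(2) by (simp add: dot_square_norm)
    have "v \<notin> T" using vv by (simp add: T_def)
    then have "T \<subset> S" using v(1) unfolding T_def by blast
    then have "dim T < dim S"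
      using T less.prems(1) by (intro dim_psubset) (simp only: span_eq_iff[THEN iffD2])
    from less.hyps[OF this T invT] obtain B where B: "finite B" "B \<subseteq> T" "T \<subseteq> span B"
      "pairwise orthogonal B" "\<forall>b\<in>B. norm b = 1" "\<forall>b\<in>B. \<exists>c. f b = c *\<^sub>R b" by blast
    have "S \<subseteq> span (insert v B)"
    proof
      fix x assume x: "x \<in> S"
      have "x - (v \<bullet> x) *\<^sub>R v \<in> T"
        using x v(1) vv less.prems(1)
        by (auto simp: T_def inner_diff_right intro!: subspace_diff subspace_scale)
      then have "x - (v \<bullet> x) *\<^sub>R v \<in> span B" using B(3) by auto
      then show "x \<in> span (insert v B)" by (auto simp: span_insert)
    qed
    moreover have "pairwise orthogonal (insert v B)"
      using B(2,4) by (auto simp: pairwise_insert orthogonal_def T_def inner_commute)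
    ultimately show ?thesis
      using B v \<open>T \<subset> S\<close> by (intro exI[of _ "insert v B"]) auto
  qed
qed

lemma pos_semidef_eigenbasis:
  fixes A :: "real^'n^'n"
  assumes "pos_semidef A"
  obtains B c where "finite B" "span B = UNIV" "pairwise orthogonal B" "\<And>b. b \<in> B \<Longrightarrow> norm b = 1"
    "\<And>b. b \<in> B \<Longrightarrow> A *v b = c b *\<^sub>R b" "\<And>b. b \<in> B \<Longrightarrow> 0 \<le> (c b :: real)"
proof -
  have "(A *v x) \<bullet> y = x \<bullet> (A *v y)" for x y
    using assms by (metis dot_lmul_matrix inner_commute pos_semidef_def transpose_matrix_vector)
  from selfadjoint_orthonormal_eigenbasis[OF matrix_vector_mul_linear this subspace_UNIV]
  obtain B where B: "finite B" "span B = UNIV" "pairwise orthogonal B" "\<And>b. b \<in> B \<Longrightarrow> norm b = 1"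
    "\<forall>b\<in>B. \<exists>c. A *v b = c *\<^sub>R b" by auto
  then obtain c where c: "\<And>b. b \<in> B \<Longrightarrow> A *v b = c b *\<^sub>R b" by metis
  have "0 \<le> c b" if "b \<in> B" for b
  proof -
    have "0 \<le> b \<bullet> (A *v b)" using assms by (simp add: pos_semidef_def)
    then show ?thesis using c[OF that] B(4)[OF that] by (simp add: dot_square_norm)
  qed
  then show thesis using that B c by blast
qed

text \<open>Keep the orthonormal eigenbasis and replace each eigenvalue by its square root;
  \<open>g\<close> is this operator as a sum of weighted projections.\<close>

lemma pos_semidef_sqrt_exists:
  fixes A :: "real^'n^'n"
  assumes "pos_semidef A"
  shows "\<exists>S. pos_semidef S \<and> S ** S = A"
proof -
  obtain B c where B: "finite B" "span B = UNIV" "pairwise orthogonal B" "\<And>b. b \<in> B \<Longrightarrow> norm b = 1"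
    "\<And>b. b \<in> B \<Longrightarrow> A *v b = c b *\<^sub>R b" "\<And>b. b \<in> B \<Longrightarrow> 0 \<le> (c b :: real)"
    using pos_semidef_eigenbasis[OF assms] by blast
  define g where "g = (\<lambda>x :: real^'n. \<Sum>b\<in>B. (sqrt (c b) * (b \<bullet> x)) *\<^sub>R b)"
  have "linear g"
    unfolding g_def
    by (intro linear_compose_sum ballI linearI)
      (simp_all add: inner_add_right algebra_simps)
  define S where "S = matrix g"
  have S: "S *v x = g x" for x
    using \<open>linear g\<close> by (simp add: S_def matrix_works)
  have gb: "g b = sqrt (c b) *\<^sub>R b" if "b \<in> B" for b
  proof -
    have "g b = (\<Sum>b'\<in>B. if b' = b then sqrt (c b) *\<^sub>R b else 0)"
      unfolding g_def using B(3) B(4) that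
      by (intro sum.cong) (auto simp: pairwise_def orthogonal_def dot_square_norm)
    then show ?thesis using that B(1) by simp
  qed
  have sym: "g x \<bullet> y = x \<bullet> g y" for x y
    unfolding g_def by (simp add: inner_sum_left inner_sum_right inner_commute mult_ac)
  have "transpose S = S"
  proof -
    have "(transpose S *v x) \<bullet> y = (S *v x) \<bullet> y" for x y
      using sym[of x y] by (metis S dot_lmul_matrix transpose_matrix_vector)
    then have "transpose S *v x = S *v x" for x by (metis vector_eq_rdot)
    then show ?thesis by (simp add: matrix_eq)
  qed
  moreover have "0 \<le> v \<bullet> (S *v v)" for v
    unfolding S g_def inner_sum_right using B(6)
    by (intro sum_nonneg) (simp add: inner_commute mult.assoc)
  moreover have "S ** S = A"
  proof -
    have "(S ** S) *v x = A *v x" for x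
    proof (rule linear_eq_on_span[of "(*v) (S ** S)" "(*v) A" B])
      fix b assume b: "b \<in> B"
      have "(S ** S) *v b = g (g b)" by (simp add: S flip: matrix_vector_mul_assoc)
      also have "\<dots> = (sqrt (c b) * sqrt (c b)) *\<^sub>R b"
        using \<open>linear g\<close> b by (simp add: gb linear_scale)
      finally show "(S ** S) *v b = A *v b" using B b by simp
    qed (use B in auto)
    then show ?thesis by (simp add: matrix_eq)
  qed
  ultimately show ?thesis by (auto simp: pos_semidef_def)
qed

text \<open>
  On an eigenvector \<open>v\<close> of \<open>S\<close> for the eigenvalue \<open>c\<close>, the vector \<open>u = (T - c) v\<close> satisfies
  \<open>(T + c) u = 0\<close>, which forces \<open>u = 0\<close> because both \<open>T\<close> and \<open>c\<close> are nonnegative.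
\<close>

lemma pos_semidef_sqrt_unique:
  fixes S T :: "real^'n^'n"
  assumes S: "pos_semidef S" and T: "pos_semidef T" and eq: "S ** S = T ** T"
  shows "S = T"
proof -
  obtain B c where B: "finite B" "span B = UNIV" "pairwise orthogonal B" "\<And>b. b \<in> B \<Longrightarrow> norm b = 1"
    "\<And>b. b \<in> B \<Longrightarrow> S *v b = c b *\<^sub>R b" "\<And>b. b \<in> B \<Longrightarrow> 0 \<le> (c b :: real)"
    using pos_semidef_eigenbasis[OF S] by blast
  have Tsym: "(T *v x) \<bullet> y = x \<bullet> (T *v y)" for x y
    using T by (metis dot_lmul_matrix inner_commute pos_semidef_def transpose_matrix_vector)
  have "S *v x = T *v x" for x
  proof (rule linear_eq_on_span[of "(*v) S" "(*v) T" B])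
    fix b assume b: "b \<in> B"
    have TT: "T *v (T *v b) = (c b * c b) *\<^sub>R b"
      using B(5)[OF b] eq by (metis matrix_vector_mul_assoc matrix_vector_mult_scaleR scaleR_scaleR)
    define u where "u = T *v b - c b *\<^sub>R b"
    have "T *v u = - c b *\<^sub>R u"
      by (simp add: u_def matrix_vector_mult_diff_distrib matrix_vector_mult_scaleR TT
          algebra_simps)
    moreover have "0 \<le> u \<bullet> (T *v u)" using T by (simp add: pos_semidef_def)
    ultimately have le: "c b * (u \<bullet> u) \<le> 0" by simp
    \<comment> \<open>For eigenvalue 0 the inequality \<open>le\<close> says nothing; there
      \<open>T *v b\<close> has squared norm \<open>b \<bullet> (T *v (T *v b)) = 0\<close>.\<close>
    have "u = 0"
    proof (cases "c b = 0")
      case True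
      then have "(T *v b) \<bullet> (T *v b) = 0" using TT by (simp add: Tsym)
      then show ?thesis using True by (simp add: u_def)
    next
      case False
      then have "u \<bullet> u \<le> 0" using le B(6)[OF b] by (simp add: mult_le_0_iff)
      then show ?thesis by (metis inner_ge_zero inner_eq_zero_iff order_antisym)
    qed
    then show "S *v b = T *v b" using B(5)[OF b] by (simp add: u_def)
  qed (use B in auto)
  then show ?thesis by (simp add: matrix_eq)
qed

lemma psd_sqrt:
  assumes "pos_semidef A"
  shows "pos_semidef (psd_sqrt A)" "psd_sqrt A ** psd_sqrt A = A"
proof -
  have "\<exists>!S. pos_semidef S \<and> S ** S = A"
    using pos_semidef_sqrt_exists[OF assms] pos_semidef_sqrt_unique by metis
  then have "pos_semidef (psd_sqrt A) \<and> psd_sqrt A ** psd_sqrt A = A"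
    unfolding psd_sqrt_def by (rule theI')
  then show "pos_semidef (psd_sqrt A)" "psd_sqrt A ** psd_sqrt A = A" by auto
qed

text \<open>The trace of \<open>A\<close> is the sum of the squared row norms of its symmetric root,
  and Cauchy-Schwarz is applied row by row.\<close>

lemma psd_sqrt_norm_le:
  fixes A :: "real^'n^'n"
  assumes "pos_semidef A"
  shows "0 \<le> trace A" "norm (psd_sqrt A *v z) \<le> sqrt (trace A) * norm z"
proof -
  let ?S = "psd_sqrt A"
  have sym: "transpose ?S = ?S" using psd_sqrt(1)[OF assms] by (simp add: pos_semidef_def)
  have "trace A = trace (?S ** transpose ?S)"
    using psd_sqrt(2)[OF assms] sym by simp
  also have "\<dots> = (\<Sum>i\<in>UNIV. ?S $ i \<bullet> ?S $ i)"
    by (simp add: trace_def matrix_matrix_mult_def transpose_def inner_vec_def)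
  finally have tr: "trace A = (\<Sum>i\<in>UNIV. (norm (?S $ i))\<^sup>2)"
    by (simp add: dot_square_norm)
  then show "0 \<le> trace A" by (simp add: sum_nonneg)
  have "(norm (?S *v z))\<^sup>2 = (\<Sum>i\<in>UNIV. (?S $ i \<bullet> z)\<^sup>2)"
    by (simp add: norm_vec_def L2_set_def sum_nonneg matrix_vector_mul_component)
  also have "\<dots> \<le> (\<Sum>i\<in>UNIV. (norm (?S $ i))\<^sup>2 * (norm z)\<^sup>2)"
    using Cauchy_Schwarz_ineq by (intro sum_mono) (simp add: power2_norm_eq_inner)
  also have "\<dots> = trace A * (norm z)\<^sup>2" by (simp add: tr sum_distrib_right)
  finally show "norm (?S *v z) \<le> sqrt (trace A) * norm z"
    using \<open>0 \<le> trace A\<close>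
    by (metis real_sqrt_le_mono real_sqrt_mult real_sqrt_abs abs_norm_cancel)
qed

section \<open>Moments of Gaussian mixtures\<close>

lemma prod_Basis_vec:
  "(\<Prod>b\<in>(Basis :: (real^'n) set). f b) = (\<Prod>i\<in>UNIV. f (axis i 1))"
proof -
  have Basis: "(Basis :: (real^'n) set) = range (\<lambda>i. axis i 1)"
    by (auto simp: Basis_vec_def)
  have "inj (\<lambda>i::'n. axis i (1::real))" by (auto simp: inj_on_def axis_eq_axis)
  then show ?thesis unfolding Basis by (subst prod.reindex) (simp_all add: comp_def)
qed

text \<open>Independence of the coordinates: density and integrand factorise, and Tonelli separates
  the integrals.\<close>

lemma nn_integral_std_gaussian_prod:
  fixes g :: "'n::finite \<Rightarrow> real \<Rightarrow> real"
  assumes g: "\<And>i. g i \<in> borel_measurable borel" "\<And>i x. 0 \<le> g i x"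
  shows "(\<integral>\<^sup>+z. ennreal (\<Prod>i\<in>UNIV. g i (z $ i)) \<partial>(std_gaussian :: (real^'n) measure))
    = (\<Prod>i\<in>UNIV. \<integral>\<^sup>+x. ennreal (std_normal_density x * g i x) \<partial>lborel)"
proof -
  define h where "h = (\<lambda>i x. ennreal (std_normal_density x * g i x))"
  \<comment> \<open>The coordinate belonging to a basis vector, since
    \<open>nn_integral_lborel_prod\<close> indexes its factors by \<open>Basis\<close>.\<close>
  define idx where "idx = (\<lambda>b :: real^'n. THE i. b = axis i 1)"
  have idx: "idx (axis i 1) = i" for i
    unfolding idx_def by (rule the_equality) (auto simp: axis_eq_axis)
  have meas [measurable]: "g i \<in> borel_measurable borel" for i by (rule g)
  have [measurable]: "(\<lambda>z :: real^'n. z $ i) \<in> borel_measurable borel" for i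
    by (intro borel_measurable_continuous_onI continuous_intros)
  have "(\<integral>\<^sup>+z. ennreal (\<Prod>i\<in>UNIV. g i (z $ i)) \<partial>(std_gaussian :: (real^'n) measure))
      = (\<integral>\<^sup>+z. ennreal (\<Prod>i\<in>UNIV. std_normal_density (z $ i)) * ennreal (\<Prod>i\<in>UNIV. g i (z $ i))
          \<partial>(lborel :: (real^'n) measure))"
    unfolding std_gaussian_def by (rule nn_integral_density) measurable
  also have "\<dots> = (\<integral>\<^sup>+z. (\<Prod>b\<in>Basis. h (idx b) (z \<bullet> b)) \<partial>(lborel :: (real^'n) measure))"
    unfolding prod_Basis_vec h_def
    by (intro nn_integral_cong)
      (simp add: idx inner_axis prod_ennreal g prod_nonneg prod.distrib flip: ennreal_mult)
  also have "\<dots> = (\<Prod>b\<in>(Basis :: (real^'n) set). \<integral>\<^sup>+x. h (idx b) x \<partial>lborel)"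
    by (intro nn_integral_lborel_prod) (auto simp: h_def)
  also have "\<dots> = (\<Prod>i\<in>UNIV. \<integral>\<^sup>+x. h i x \<partial>lborel)"
    by (simp add: prod_Basis_vec idx)
  finally show ?thesis by (simp add: h_def)
qed

lemma prob_space_std_gaussian: "prob_space (std_gaussian :: (real^'n) measure)"
proof
  have "emeasure (std_gaussian :: (real^'n) measure) (space std_gaussian)
      = (\<integral>\<^sup>+z. ennreal (\<Prod>i\<in>(UNIV :: 'n set). 1) \<partial>(std_gaussian :: (real^'n) measure))"
    by simp
  also have "\<dots> = (\<Prod>i\<in>(UNIV :: 'n set). \<integral>\<^sup>+x. ennreal (std_normal_density x * 1) \<partial>lborel)"
    by (rule nn_integral_std_gaussian_prod) auto
  also have "(\<integral>\<^sup>+x. ennreal (std_normal_density x * 1) \<partial>lborel) = ennreal 1"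
    using nn_integral_eq_integral[OF integrable_normal_moment[of 1 0 0]]
        integral_std_normal_moment_even[of 0]
    by (simp add: integrable_std_normal_moment)
  finally show "emeasure (std_gaussian :: (real^'n) measure) (space std_gaussian) = 1" by simp
qed

lemma sets_std_gaussian [simp, measurable_cong]: "sets std_gaussian = sets borel"
  by (simp add: std_gaussian_def)

text \<open>All factors but one have integrand weight 1, and the remaining one is a one-dimensional
  moment. Even exponents keep the integrand nonnegative.\<close>

lemma nn_integral_std_gaussian_component_power:
  "(\<integral>\<^sup>+z. ennreal ((z $ k) ^ (2 * m)) \<partial>(std_gaussian :: (real^'n) measure)) < \<infinity>"
proof -
  define g where "g = (\<lambda>i x :: real. if i = k then x ^ (2 * m) else 1)"
  have nn: "0 \<le> g i x" for i x by (simp add: g_def)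
  have "(\<Prod>i\<in>UNIV. g i (z $ i)) = (z $ k) ^ (2 * m)" for z :: "real^'n"
    by (simp add: g_def prod.If_cases)
  then have "(\<integral>\<^sup>+z. ennreal ((z $ k) ^ (2 * m)) \<partial>(std_gaussian :: (real^'n) measure))
      = (\<integral>\<^sup>+z. ennreal (\<Prod>i\<in>UNIV. g i (z $ i)) \<partial>(std_gaussian :: (real^'n) measure))"
    by simp
  also have "\<dots> = (\<Prod>i\<in>UNIV. \<integral>\<^sup>+x. ennreal (std_normal_density x * g i x) \<partial>lborel)"
    by (rule nn_integral_std_gaussian_prod[OF _ nn]) (simp add: g_def)
  also have "\<dots> < \<infinity>"
  proof -
    have "(\<integral>\<^sup>+x. ennreal (std_normal_density x * g i x) \<partial>lborel)
        = ennreal (\<integral>x. std_normal_density x * g i x \<partial>lborel)" for i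
    proof -
      have "integrable lborel (\<lambda>x. std_normal_density x * g i x)"
        using integrable_std_normal_moment[of "2 * m"] integrable_std_normal_moment[of 0]
        by (cases "i = k") (simp_all add: g_def)
      then show ?thesis by (rule nn_integral_eq_integral) (simp add: nn)
    qed
    moreover have "0 \<le> (\<integral>x. std_normal_density x * g i x \<partial>lborel)" for i
      by (simp add: nn)
    ultimately show ?thesis by (simp add: prod_ennreal)
  qed
  finally show ?thesis .
qed

text \<open>The term 1 covers the unit ball; outside it the exponent may be raised to an even
  integer, which reduces real exponents to coordinate moments.\<close>

lemma norm_powr_le_sum_components:
  fixes z :: "real^'n"
  assumes "0 \<le> p" "p \<le> real (2 * m)"
  shows "norm z powr p \<le> 1 + real CARD('n) ^ (2 * m) * (\<Sum>i\<in>UNIV. (z $ i) ^ (2 * m))"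
proof -
  \<comment> \<open>A coordinate \<open>k\<close> of largest modulus controls the norm up to the
    factor \<open>CARD('n)\<close>.\<close>
  have "Max (range (\<lambda>i. \<bar>z $ i\<bar>)) \<in> range (\<lambda>i. \<bar>z $ i\<bar>)" by (intro Max_in) auto
  then obtain k where "Max (range (\<lambda>i. \<bar>z $ i\<bar>)) = \<bar>z $ k\<bar>" by (rule imageE)
  moreover have "\<bar>z $ i\<bar> \<le> Max (range (\<lambda>i. \<bar>z $ i\<bar>))" for i by (intro Max_ge) auto
  ultimately have k: "\<bar>z $ i\<bar> \<le> \<bar>z $ k\<bar>" for i by simp
  have "norm z \<le> (\<Sum>i\<in>UNIV. \<bar>z $ i\<bar>)" by (rule norm_le_l1_cart)
  also have "\<dots> \<le> real CARD('n) * \<bar>z $ k\<bar>" using k by (intro sum_bounded_above) auto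
  finally have "norm z ^ (2 * m) \<le> (real CARD('n) * \<bar>z $ k\<bar>) ^ (2 * m)" by (intro power_mono) auto
  also have "\<dots> = real CARD('n) ^ (2 * m) * (z $ k) ^ (2 * m)"
    by (simp add: power_mult_distrib power_even_abs)
  also have "\<dots> \<le> real CARD('n) ^ (2 * m) * (\<Sum>i\<in>UNIV. (z $ i) ^ (2 * m))"
    by (intro mult_left_mono member_le_sum) auto
  finally have *: "norm z ^ (2 * m) \<le> real CARD('n) ^ (2 * m) * (\<Sum>i\<in>UNIV. (z $ i) ^ (2 * m))" .
  show ?thesis
  proof (cases "norm z \<le> 1")
    case True
    then have "norm z powr p \<le> 1" using assms(1) by (intro powr_le1) auto
    moreover have "0 \<le> norm z ^ (2 * m)" by simp
    ultimately show ?thesis using * by linarith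
  next
    case False
    then have "norm z powr p \<le> norm z powr real (2 * m)" using assms(2) by (intro powr_mono) auto
    also have "\<dots> = norm z ^ (2 * m)" using False by (intro powr_realpow) linarith
    finally show ?thesis using * by linarith
  qed
qed

text \<open>Domination by even coordinate moments gives integrability, which identifies the Bochner
  integral \<open>gaussian_moment\<close> with the true moment.\<close>

lemma nn_integral_std_gaussian_norm_powr:
  assumes "0 \<le> p"
  shows "(\<integral>\<^sup>+z. ennreal (norm z powr p) \<partial>(std_gaussian :: (real^'n) measure))
    = ennreal (gaussian_moment TYPE('n) p)"
proof -
  interpret prob_space "std_gaussian :: (real^'n) measure" by (rule prob_space_std_gaussian)
  obtain m :: nat where "p \<le> real m" using real_arch_simple by blast
  then have m: "p \<le> real (2 * m)" by simp
  let ?c = "real CARD('n) ^ (2 * m)"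
  have [measurable]: "(\<lambda>z :: real^'n. z $ i) \<in> borel_measurable borel" for i
    by (intro borel_measurable_continuous_onI continuous_intros)
  have "(\<integral>\<^sup>+z. ennreal (norm z powr p) \<partial>(std_gaussian :: (real^'n) measure))
      \<le> (\<integral>\<^sup>+z. 1 + ennreal ?c * (\<Sum>i\<in>UNIV. ennreal ((z $ i) ^ (2 * m)))
          \<partial>(std_gaussian :: (real^'n) measure))"
    using norm_powr_le_sum_components[OF assms m]
    by (intro nn_integral_mono)
      (simp add: sum_nonneg flip: ennreal_mult ennreal_1 ennreal_plus)
  also have "\<dots> = 1 + ennreal ?c * (\<Sum>i\<in>UNIV. \<integral>\<^sup>+z. ennreal ((z $ i) ^ (2 * m))
      \<partial>(std_gaussian :: (real^'n) measure))"
    by (simp add: nn_integral_add nn_integral_cmult nn_integral_sum emeasure_space_1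
        del: sum_ennreal)
  also have "\<dots> < \<infinity>"
    using nn_integral_std_gaussian_component_power[where 'n='n]
    by (simp add: ennreal_mult_less_top ennreal_add_less_top less_top)
  finally have "integrable (std_gaussian :: (real^'n) measure) (\<lambda>z. norm z powr p)"
    by (intro integrableI_nonneg) auto
  then show ?thesis unfolding gaussian_moment_def by (rule nn_integral_eq_integral) simp
qed

text \<open>Convexity at the midpoint of \<open>a\<close> and \<open>b\<close>. If one of them is 0,
  it suffices that the factor \<open>2 powr (p - 1)\<close> is at least 1.\<close>

lemma powr_add_le:
  fixes a b :: real
  assumes "0 \<le> a" "0 \<le> b" "1 \<le> p"
  shows "(a + b) powr p \<le> 2 powr (p - 1) * (a powr p + b powr p)"
proof -
  have ge1: "1 \<le> (2::real) powr (p - 1)" using assms(3) by (intro ge_one_powr_ge_zero) auto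
  consider "a = 0" | "b = 0" | "0 < a" "0 < b" using assms by fastforce
  then show ?thesis
  proof cases
    case 3
    have "((a + b) / 2) powr p \<le> (a powr p + b powr p) / 2"
      using convex_onD[OF powr_convex[OF assms(3)], of "1/2" a b] 3 by (simp add: field_simps)
    moreover have "(a + b) powr p = 2 powr (p - 1) * (2 * ((a + b) / 2) powr p)"
      using 3 by (simp add: powr_divide powr_diff)
    ultimately show ?thesis by simp
  qed (use mult_right_mono[OF ge1, of "a powr p"] mult_right_mono[OF ge1, of "b powr p"] in auto)
qed

section \<open>Norm moments of Gaussian laws and their mixtures\<close>

lemma trace_scaleR: "trace (c *\<^sub>R A) = c * trace (A :: real^'n^'n)"
  by (simp add: trace_def sum_distrib_left)

lemma pos_semidef_scaleR: "0 \<le> c \<Longrightarrow> pos_semidef A \<Longrightarrow> pos_semidef (c *\<^sub>R A)"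
  by (auto simp: pos_semidef_def transpose_def vec_eq_iff scaleR_matrix_vector_assoc[symmetric])

lemma measurable_psd_sqrt_affine [measurable]:
  "(\<lambda>z. m + psd_sqrt A *v z) \<in> borel_measurable borel"
  by (intro borel_measurable_continuous_onI continuous_intros
      matrix_vector_mult_linear_continuous_on)

lemma sets_gaussian [simp, measurable_cong]: "sets (gaussian m A) = sets borel"
  by (simp add: gaussian_def)

lemma prob_space_gaussian: "prob_space (gaussian m A)"
  unfolding gaussian_def by (intro prob_space.prob_space_distr prob_space_std_gaussian) simp

lemma nn_integral_gaussian_norm_powr_le:
  fixes m :: "real^'n"
  assumes A: "pos_semidef A" and p: "1 \<le> p"
  shows "(\<integral>\<^sup>+y. ennreal (norm y powr p) \<partial>gaussian m A)
    \<le> ennreal (2 powr (p - 1) *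
        (norm m powr p + gaussian_moment TYPE('n) p * trace A powr (p / 2)))"
proof -
  interpret prob_space "std_gaussian :: (real^'n) measure" by (rule prob_space_std_gaussian)
  have \<kappa>: "0 \<le> gaussian_moment TYPE('n) p" by (simp add: gaussian_moment_def)
  have "(\<integral>\<^sup>+y. ennreal (norm y powr p) \<partial>gaussian m A)
      = (\<integral>\<^sup>+z. ennreal (norm (m + psd_sqrt A *v z) powr p) \<partial>std_gaussian)"
    unfolding gaussian_def by (rule nn_integral_distr) auto
  also have "\<dots> \<le> (\<integral>\<^sup>+z. ennreal (2 powr (p - 1) * norm m powr p)
      + ennreal (2 powr (p - 1) * trace A powr (p / 2)) * ennreal (norm z powr p)
          \<partial>(std_gaussian :: (real^'n) measure))"
  proof (intro nn_integral_mono)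
    fix z :: "real^'n"
    have "norm (m + psd_sqrt A *v z) \<le> norm m + sqrt (trace A) * norm z"
      using norm_triangle_ineq[of m "psd_sqrt A *v z"] psd_sqrt_norm_le(2)[OF A, of z] by linarith
    then have "norm (m + psd_sqrt A *v z) powr p \<le> (norm m + sqrt (trace A) * norm z) powr p"
      using p by (intro powr_mono2) auto
    also have "\<dots> \<le> 2 powr (p - 1) * (norm m powr p + (sqrt (trace A) * norm z) powr p)"
      using p psd_sqrt_norm_le(1)[OF A] by (intro powr_add_le) auto
    also have "(sqrt (trace A) * norm z) powr p = trace A powr (p / 2) * norm z powr p"
      using psd_sqrt_norm_le(1)[OF A] by (simp add: powr_mult powr_powr flip: powr_half_sqrt)
    finally show "ennreal (norm (m + psd_sqrt A *v z) powr p)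
        \<le> ennreal (2 powr (p - 1) * norm m powr p)
          + ennreal (2 powr (p - 1) * trace A powr (p / 2)) * ennreal (norm z powr p)"
      by (simp add: algebra_simps flip: ennreal_mult ennreal_plus)
  qed
  also have "\<dots> = ennreal (2 powr (p - 1) * norm m powr p)
      + ennreal (2 powr (p - 1) * trace A powr (p / 2)) * ennreal (gaussian_moment TYPE('n) p)"
    using p by (simp add: nn_integral_add nn_integral_cmult emeasure_space_1
        nn_integral_std_gaussian_norm_powr)
  also have "\<dots> = ennreal (2 powr (p - 1) * (norm m powr p + gaussian_moment TYPE('n) p
      * trace A powr (p / 2)))"
    using \<kappa> by (simp add: algebra_simps flip: ennreal_mult ennreal_plus)
  finally show ?thesis .
qed

text \<open>\<open>measure_of\<close> has the prescribed values only if these form a measure.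
  Identifying the mixture with a \<open>bind\<close> (draw an index, then a Gaussian point) supplies
  this and the integration formula at once.\<close>

lemma nn_integral_gaussian_mixture:
  fixes m :: "nat \<Rightarrow> real^'n"
  assumes K: "K \<ge> 1" and f [measurable]: "f \<in> borel_measurable borel"
  shows "(\<integral>\<^sup>+y. f y \<partial>gaussian_mixture K w m A)
    = (\<Sum>k = 1..K. ennreal (w k) * (\<integral>\<^sup>+y. f y \<partial>gaussian (m k) (A k)))"
proof -
  define P where "P = point_measure {1..K} (\<lambda>k. ennreal (w k))"
  define B where "B = P \<bind> (\<lambda>k. gaussian (m k) (A k))"
  \<comment> \<open>The formula for \<open>bind\<close> needs a nonempty index space, hence
    \<open>K \<ge> 1\<close>.\<close>
  have ne: "space P \<noteq> {}" using K by (simp add: P_def space_point_measure)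
  have meas: "(\<lambda>k. gaussian (m k) (A k)) \<in> measurable P (subprob_algebra borel)"
    by (auto simp: P_def measurable_point_measure_eq1 space_subprob_algebra
        intro: prob_space_imp_subprob_space prob_space_gaussian)
  have "gaussian_mixture K w m A = B"
  proof -
    have sets: "sets B = sets borel" "space B = UNIV"
      using sets_bind[OF _ ne, of "\<lambda>k. gaussian (m k) (A k)" borel]
      by (auto simp: B_def dest: sets_eq_imp_space_eq)
    have "emeasure B E = (\<Sum>k = 1..K. ennreal (w k) * emeasure (gaussian (m k) (A k)) E)"
      if "E \<in> sets borel" for E
      using emeasure_bind[OF ne meas that]
      by (simp add: B_def P_def nn_integral_point_measure_finite)
    then have "gaussian_mixture K w m A = measure_of (space B) (sets B) (emeasure B)"
      unfolding gaussian_mixture_def sets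
      by (intro measure_of_eq) (auto simp: sets.sigma_sets_eq[of borel, simplified])
    then show ?thesis by (simp add: measure_of_of_measure)
  qed
  then show ?thesis
    using nn_integral_bind[OF f meas] by (simp add: B_def P_def nn_integral_point_measure_finite)
qed

text \<open>The scale enters only through the traces, whose power \<open>p / 2\<close> releases the
  factor \<open>\<eta> powr (p / 2)\<close>.\<close>

lemma nn_integral_gaussian_mixture_norm_powr_le:
  fixes \<mu> :: "nat \<Rightarrow> real^'n"
  assumes "K \<ge> 1" and w: "\<And>k. k \<in> {1..K} \<Longrightarrow> 0 \<le> w k"
    and A: "\<And>k. k \<in> {1..K} \<Longrightarrow> pos_semidef (\<Sigma> k)" and p: "1 \<le> p" and \<eta>: "0 < \<eta>"
  shows "(\<integral>\<^sup>+y. ennreal (norm y powr p) \<partial>gaussian_mixture K w \<mu> (\<lambda>k. \<eta> *\<^sub>R \<Sigma> k))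
    \<le> ennreal (mean_const K w \<mu> p + cov_const K w \<Sigma> p * \<eta> powr (p / 2))"
proof -
  let ?\<kappa> = "gaussian_moment TYPE('n) p"
  let ?b = "\<lambda>k. 2 powr (p - 1) * (norm (\<mu> k) powr p + ?\<kappa> * trace (\<eta> *\<^sub>R \<Sigma> k) powr (p / 2))"
  have \<kappa>: "0 \<le> ?\<kappa>" by (simp add: gaussian_moment_def)
  have "(\<integral>\<^sup>+y. ennreal (norm y powr p) \<partial>gaussian_mixture K w \<mu> (\<lambda>k. \<eta> *\<^sub>R \<Sigma> k))
      = (\<Sum>k = 1..K. ennreal (w k) * (\<integral>\<^sup>+y. ennreal (norm y powr p) \<partial>gaussian (\<mu> k) (\<eta> *\<^sub>R \<Sigma> k)))"
    by (intro nn_integral_gaussian_mixture assms) simp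
  also have "\<dots> \<le> (\<Sum>k = 1..K. ennreal (w k) * ennreal (?b k))"
    using A \<eta> p
    by (intro sum_mono mult_left_mono nn_integral_gaussian_norm_powr_le pos_semidef_scaleR) auto
  also have "\<dots> = (\<Sum>k = 1..K. ennreal (w k * ?b k))"
    using w \<kappa> by (intro sum.cong) (auto simp: ennreal_mult)
  also have "\<dots> = ennreal (\<Sum>k = 1..K. w k * ?b k)"
    using w \<kappa> by (intro sum_ennreal) auto
  also have "(\<Sum>k = 1..K. w k * ?b k) = (\<Sum>k = 1..K. 2 powr (p - 1) * (w k * norm (\<mu> k) powr p)
      + 2 powr (p - 1) * ?\<kappa> * (w k * trace (\<Sigma> k) powr (p / 2)) * \<eta> powr (p / 2))"
    using psd_sqrt_norm_le(1)[OF A] \<eta>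
    by (intro sum.cong) (auto simp: trace_scaleR powr_mult algebra_simps)
  also have "\<dots> = mean_const K w \<mu> p + cov_const K w \<Sigma> p * \<eta> powr (p / 2)"
    by (simp add: mean_const_def cov_const_def sum.distrib sum_distrib_left sum_distrib_right)
  finally show ?thesis .
qed

section \<open>Moments of the persistence\<close>

text \<open>A point of largest norm serves as the radius in \<open>total_persistence_le\<close>.
  Passing to the sum over all points leaves an expression whose expectation needs no joint
  law.\<close>

lemma persistence_powr_le:
  fixes x :: "nat \<Rightarrow> 'a::real_normed_vector"
  assumes L: "L \<in> {total_persistence l N, max_persistence l N}" and N: "N \<ge> 1" and p: "1 \<le> p"
  shows "0 \<le> L x"
    "L x powr p \<le> 2 powr p * real (min (N choose (l + 1)) (N choose (l + 2))) powr p
      * (\<Sum>i = 1..N. norm (x i) powr p)"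
proof -
  let ?c = "real (min (N choose (l + 1)) (N choose (l + 2)))"
  show nonneg: "0 \<le> L x" using L total_persistence_nonneg max_persistence_nonneg by auto
  have "Max ((\<lambda>i. norm (x i)) ` {1..N}) \<in> (\<lambda>i. norm (x i)) ` {1..N}" using N by (intro Max_in) auto
  then obtain k where k: "Max ((\<lambda>i. norm (x i)) ` {1..N}) = norm (x k)" "k \<in> {1..N}"
      by (rule imageE)
  have "norm (x i) \<le> norm (x k)" if "i \<in> {1..N}" for i
    unfolding k(1)[symmetric] using that by (intro Max_ge) auto
  then have "total_persistence l N x \<le> 2 * norm (x k) * ?c" by (rule total_persistence_le)
  then have "L x \<le> 2 * norm (x k) * ?c" using L max_persistence_le_total[of l N x] by auto
  then have "L x powr p \<le> (2 * norm (x k) * ?c) powr p" using nonneg p by (intro powr_mono2) auto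
  also have "\<dots> = 2 powr p * ?c powr p * norm (x k) powr p" by (simp add: powr_mult mult_ac)
  also have "\<dots> \<le> 2 powr p * ?c powr p * (\<Sum>i = 1..N. norm (x i) powr p)"
    using k(2) by (intro mult_left_mono member_le_sum) auto
  finally show "L x powr p \<le> 2 powr p * ?c powr p * (\<Sum>i = 1..N. norm (x i) powr p)" .
qed

text \<open>All marginals have the same law, so they contribute \<open>N\<close> equal bounds; this
  is the factor \<open>N\<close> in \<open>vr_const\<close>.\<close>

lemma nn_integral_persistence_powr_le:
  fixes \<mu> :: "nat \<Rightarrow> real^'n"
  assumes K: "K \<ge> 1" and N: "N \<ge> 1"
    and w: "\<And>k. k \<in> {1..K} \<Longrightarrow> w k \<ge> 0"
    and \<Sigma>: "\<And>k. k \<in> {1..K} \<Longrightarrow> pos_semidef (\<Sigma> k)"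
    and \<eta>: "\<eta> > 0"
    and X: "\<And>i. i \<in> {1..N} \<Longrightarrow> X i \<in> borel_measurable M"
    and law: "\<And>i. i \<in> {1..N} \<Longrightarrow> distr M borel (X i) = gaussian_mixture K w \<mu> (\<lambda>k. \<eta> *\<^sub>R \<Sigma> k)"
    and L: "L \<in> {total_persistence l N, max_persistence l N}" and p: "p \<ge> 1"
  shows "(\<integral>\<^sup>+\<omega>. ennreal (L (\<lambda>i. X i \<omega>) powr p) \<partial>M)
    \<le> ennreal (mean_const K w \<mu> p * vr_const l p N + cov_const K w \<Sigma> p * vr_const l p N
      * \<eta> powr (p / 2))"
proof -
  let ?c = "2 powr p * real (min (N choose (l + 1)) (N choose (l + 2))) powr p"
  let ?b = "mean_const K w \<mu> p + cov_const K w \<Sigma> p * \<eta> powr (p / 2)"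
  have "(\<integral>\<^sup>+\<omega>. ennreal (L (\<lambda>i. X i \<omega>) powr p) \<partial>M)
      \<le> (\<integral>\<^sup>+\<omega>. ennreal ?c * (\<Sum>i = 1..N. ennreal (norm (X i \<omega>) powr p)) \<partial>M)"
    using persistence_powr_le(2)[OF L N p]
    by (intro nn_integral_mono) (simp add: sum_nonneg flip: ennreal_mult)
  also have "\<dots> = ennreal ?c * (\<Sum>i = 1..N. \<integral>\<^sup>+\<omega>. ennreal (norm (X i \<omega>) powr p) \<partial>M)"
  proof -
    have meas: "(\<lambda>\<omega>. ennreal (norm (X i \<omega>) powr p)) \<in> borel_measurable M" if "i \<in> {1..N}" for i
      using X[OF that] by measurable
    show ?thesis
      by (simp only: nn_integral_cmult[OF borel_measurable_sum[OF meas]] nn_integral_sum[OF meas])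
  qed
  also have "(\<Sum>i = 1..N. \<integral>\<^sup>+\<omega>. ennreal (norm (X i \<omega>) powr p) \<partial>M) \<le> (\<Sum>i = 1..N. ennreal ?b)"
  proof (rule sum_mono)
    fix i assume i: "i \<in> {1..N}"
    have "(\<integral>\<^sup>+\<omega>. ennreal (norm (X i \<omega>) powr p) \<partial>M)
        = (\<integral>\<^sup>+y. ennreal (norm y powr p) \<partial>distr M borel (X i))"
      by (rule nn_integral_distr[OF X[OF i], symmetric]) simp
    also have "\<dots> \<le> ennreal ?b"
      unfolding law[OF i] by (rule nn_integral_gaussian_mixture_norm_powr_le[OF K w \<Sigma> p \<eta>])
    finally show "(\<integral>\<^sup>+\<omega>. ennreal (norm (X i \<omega>) powr p) \<partial>M) \<le> ennreal ?b" .
  qed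
  also have "ennreal ?c * (\<Sum>i = 1..N. ennreal ?b) = ennreal (?c * (real N * ?b))"
    by (simp add: ennreal_mult' ennreal_of_nat_eq_real_of_nat flip: ennreal_mult')
  also have "?c * (real N * ?b)
      = mean_const K w \<mu> p * vr_const l p N + cov_const K w \<Sigma> p * vr_const l p N * \<eta> powr (p / 2)"
    by (simp add: vr_const_def algebra_simps)
  finally show ?thesis by (simp add: mult_left_mono)
qed

text \<open>Rescaling divides the moment by \<open>s = \<eta> powr (p / 2)\<close>, leaving
  \<open>a / s + b\<close>, and \<open>s \<ge> 1\<close> for \<open>\<eta> \<ge> 1\<close>.\<close>

lemma SUP_nn_integral_rescaled_le:
  fixes Y :: "real \<Rightarrow> 'w \<Rightarrow> real"
  assumes meas: "\<And>\<eta>. \<eta> > 0 \<Longrightarrow> Y \<eta> \<in> borel_measurable (M \<eta>)" and nn: "\<And>\<eta> \<omega>. 0 \<le> Y \<eta> \<omega>"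
    and a: "0 \<le> a" and b: "0 \<le> b" and p: "0 \<le> p"
    and le: "\<And>\<eta>. \<eta> > 0 \<Longrightarrow> (\<integral>\<^sup>+\<omega>. ennreal (Y \<eta> \<omega> powr p) \<partial>M \<eta>) \<le> ennreal (a + b * \<eta> powr (p / 2))"
  shows "(SUP \<eta>\<in>{1..}. \<integral>\<^sup>+\<omega>. ennreal ((Y \<eta> \<omega> / sqrt \<eta>) powr p) \<partial>M \<eta>) \<le> ennreal (a + b)"
proof (rule SUP_least)
  fix \<eta> :: real assume "\<eta> \<in> {1..}"
  then have \<eta>: "1 \<le> \<eta>" "0 < \<eta>" by auto
  note [measurable] = meas[OF \<eta>(2)]
  define s where "s = \<eta> powr (p / 2)"
  have s: "1 \<le> s" "sqrt \<eta> powr p = s" using \<eta> p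
    by (simp_all add: s_def ge_one_powr_ge_zero powr_powr flip: powr_half_sqrt)
  have "(\<integral>\<^sup>+\<omega>. ennreal ((Y \<eta> \<omega> / sqrt \<eta>) powr p) \<partial>M \<eta>)
      = (\<integral>\<^sup>+\<omega>. ennreal (1 / s) * ennreal (Y \<eta> \<omega> powr p) \<partial>M \<eta>)"
    using nn \<eta> s by (intro nn_integral_cong) (simp add: powr_divide flip: ennreal_mult)
  also have "\<dots> = ennreal (1 / s) * (\<integral>\<^sup>+\<omega>. ennreal (Y \<eta> \<omega> powr p) \<partial>M \<eta>)"
    by (rule nn_integral_cmult) simp
  also have "\<dots> \<le> ennreal (1 / s) * ennreal (a + b * s)"
    unfolding s_def by (intro mult_left_mono le \<eta>) simp
  also have "\<dots> = ennreal (1 / s * (a + b * s))"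
    using s(1) by (intro ennreal_mult'[symmetric]) simp
  also have "1 / s * (a + b * s) = a / s + b"
    using s(1) by (simp add: field_simps)
  also have "\<dots> \<le> ennreal (a + b)"
    using s(1) a by (intro ennreal_leI add_right_mono) (simp add: divide_le_eq mult_le_cancel_left1)
  finally show "(\<integral>\<^sup>+\<omega>. ennreal ((Y \<eta> \<omega> / sqrt \<eta>) powr p) \<partial>M \<eta>) \<le> ennreal (a + b)" .
qed

text \<open>The measurability conjunct makes the nonnegative integrals genuine expectations, and the
  finite bounds include the existence of the moments.\<close>

theorem theorem5:
  fixes K N l :: nat
    and w :: "nat \<Rightarrow> real"
    and \<mu> :: "nat \<Rightarrow> real^'n"
    and \<Sigma> :: "nat \<Rightarrow> real^'n^'n"
    and M :: "real \<Rightarrow> 'w measure"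
    and X :: "real \<Rightarrow> nat \<Rightarrow> 'w \<Rightarrow> real^'n"
    and L :: "(nat \<Rightarrow> real^'n) \<Rightarrow> real"
    and p :: real
  assumes "K \<ge> 1" and "N \<ge> 1"
    and "\<And>k. k \<in> {1..K} \<Longrightarrow> w k \<ge> 0" and "(\<Sum>k = 1..K. w k) = 1"
    and "\<And>k. k \<in> {1..K} \<Longrightarrow> pos_semidef (\<Sigma> k)"
    and "\<And>\<eta>. \<eta> > 0 \<Longrightarrow> prob_space (M \<eta>)"
    and "\<And>\<eta> i. \<eta> > 0 \<Longrightarrow> i \<in> {1..N} \<Longrightarrow> X \<eta> i \<in> borel_measurable (M \<eta>)"
    and "\<And>\<eta> i. \<eta> > 0 \<Longrightarrow> i \<in> {1..N} \<Longrightarrow>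
           distr (M \<eta>) borel (X \<eta> i) = gaussian_mixture K w \<mu> (\<lambda>k. \<eta> *\<^sub>R \<Sigma> k)"
    and "L \<in> {total_persistence l N, max_persistence l N}"
    and "p \<ge> 1"
  shows "(\<forall>\<eta>>0. (\<lambda>\<omega>. L (\<lambda>i. X \<eta> i \<omega>)) \<in> borel_measurable (M \<eta>)) \<and>
         (\<exists>C0>0. \<exists>C1>0.
           (\<forall>\<eta>>0. (\<integral>\<^sup>+\<omega>. ennreal (L (\<lambda>i. X \<eta> i \<omega>) powr p) \<partial>M \<eta>)
                     \<le> ennreal (C0 + C1 * \<eta> powr (p / 2))) \<and>
           (SUP \<eta>\<in>{1..}. \<integral>\<^sup>+\<omega>. ennreal ((L (\<lambda>i. X \<eta> i \<omega>) / sqrt \<eta>) powr p) \<partial>M \<eta>)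
             \<le> ennreal (C0 + C1)) \<and>
         (\<forall>\<eta>>0. (\<integral>\<^sup>+\<omega>. ennreal (L (\<lambda>i. X \<eta> i \<omega>) powr p) \<partial>M \<eta>)
           \<le> ennreal (mean_const K w \<mu> p * vr_const l p N
                      + cov_const K w \<Sigma> p * vr_const l p N * \<eta> powr (p / 2))) \<and>
         ((SUP \<eta>\<in>{1..}. \<integral>\<^sup>+\<omega>. ennreal ((L (\<lambda>i. X \<eta> i \<omega>) / sqrt \<eta>) powr p) \<partial>M \<eta>)
           \<le> ennreal (mean_const K w \<mu> p * vr_const l p N + cov_const K w \<Sigma> p * vr_const l p N))"
proof -
  let ?C0 = "mean_const K w \<mu> p * vr_const l p N" and ?C1 = "cov_const K w \<Sigma> p * vr_const l p N"
  have vr: "0 \<le> vr_const l p N" by (simp add: vr_const_def)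
  have C0: "0 \<le> ?C0"
    using assms(3) vr by (intro mult_nonneg_nonneg) (auto simp: mean_const_def intro!: sum_nonneg
        mult_nonneg_nonneg)
  have C1: "0 \<le> ?C1"
    using assms(3) vr
    by (intro mult_nonneg_nonneg)
      (auto simp: cov_const_def gaussian_moment_def intro!: sum_nonneg mult_nonneg_nonneg)
  have meas: "(\<lambda>\<omega>. L (\<lambda>i. X \<eta> i \<omega>)) \<in> borel_measurable (M \<eta>)" if "\<eta> > 0" for \<eta>
    using assms(9) borel_measurable_total_persistence[OF assms(7)[OF that]]
      borel_measurable_max_persistence[OF assms(7)[OF that]] by auto
  have le: "(\<integral>\<^sup>+\<omega>. ennreal (L (\<lambda>i. X \<eta> i \<omega>) powr p) \<partial>M \<eta>) \<le> ennreal (?C0 + ?C1 * \<eta> powr (p / 2))"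
    if "\<eta> > 0" for \<eta>
    using that assms by (intro nn_integral_persistence_powr_le) auto
  have sup: "(SUP \<eta>\<in>{1..}. \<integral>\<^sup>+\<omega>. ennreal ((L (\<lambda>i. X \<eta> i \<omega>) / sqrt \<eta>) powr p) \<partial>M \<eta>)
      \<le> ennreal (?C0 + ?C1)"
    using meas le C0 C1 assms(10) persistence_powr_le(1)[OF assms(9) assms(2) assms(10)]
    by (intro SUP_nn_integral_rescaled_le) auto
  have ex: "\<exists>C0>0. \<exists>C1>0.
      (\<forall>\<eta>>0. (\<integral>\<^sup>+\<omega>. ennreal (L (\<lambda>i. X \<eta> i \<omega>) powr p) \<partial>M \<eta>) \<le> ennreal (C0 + C1 * \<eta> powr (p / 2))) \<and>
      (SUP \<eta>\<in>{1..}. \<integral>\<^sup>+\<omega>. ennreal ((L (\<lambda>i. X \<eta> i \<omega>) / sqrt \<eta>) powr p) \<partial>M \<eta>) \<le> ennreal (C0 + C1)"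
  \<comment> \<open>The explicit constants vanish, for example, if \<open>N < l + 2\<close>, whereas
    strictly positive ones are demanded here; adding 1 to each preserves both bounds.\<close>
  proof (rule exI[of _ "?C0 + 1"], rule conjI, goal_cases)
    case 2
    show ?case
    proof (rule exI[of _ "?C1 + 1"], intro conjI allI impI)
      fix \<eta> :: real assume \<eta>: "\<eta> > 0"
      have "?C0 + ?C1 * \<eta> powr (p / 2) \<le> ?C0 + 1 + (?C1 + 1) * \<eta> powr (p / 2)"
        by (simp add: distrib_right)
      then show "(\<integral>\<^sup>+\<omega>. ennreal (L (\<lambda>i. X \<eta> i \<omega>) powr p) \<partial>M \<eta>)
          \<le> ennreal (?C0 + 1 + (?C1 + 1) * \<eta> powr (p / 2))"
        using le[OF \<eta>] by (meson ennreal_leI order_trans)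
    next
      show "(SUP \<eta>\<in>{1..}. \<integral>\<^sup>+\<omega>. ennreal ((L (\<lambda>i. X \<eta> i \<omega>) / sqrt \<eta>) powr p) \<partial>M \<eta>)
          \<le> ennreal (?C0 + 1 + (?C1 + 1))"
        using sup by (rule order_trans) (simp add: ennreal_leI)
    qed (use C1 in linarith)
  qed (use C0 in linarith)
  show ?thesis
    using meas le sup by (intro conjI ex allI impI)
qed

end
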